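(* Let $\Phi$ be a Young's function and let $(X,\mathcal{F},\mu,\varphi)$ be a dissipative system of bounded distortion generated by $W$ such that $\varphi$ and $\varphi^{-1}$ satisfy the domination condition and $C_\varphi$ is an invertible operator on $L^{\Phi}(\mu)$. Put $a_k=\Phi^{-1}\left(\frac{1}{\mu(\varphi^{k}(W))}\right)$ for $k\in\mathbb{Z}$. Then the following are equivalent: (1) The composition operator $C_\varphi:L^\Phi(\mu)\to L^\Phi(\mu)$ has the shadowing property. (2) At least one of the following three conditions holds: (C) $\limsup_{n\to\infty}\sup_{k\in\mathbb{Z}}\left(\frac{a_{k+n}}{a_k}\right)^{1/n}<1$; (D) $\liminf_{n\to\infty}\inf_{k\in\mathbb{Z}}\left(\frac{a_{k+n}}{a_k}\right)^{1/n}>1$; (GH) $\limsup_{n\to\infty}\sup_{k\in-\mathbb{N}_0}\left(\frac{a_{k}}{a_{k-n}}\right)^{1/n}<1$ and $\liminf_{n\to\infty}\inf_{k\in\mathbb{N}_0}\left(\frac{a_{k+n}}{a_{k}}\right)^{1/n}>1$.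
   Context: A Young's function is a convex even function $\Phi:\mathbb{R}\to[0,\infty]$ with $\Phi(0)=0$ and $\lim_{x\to\infty}\Phi(x)=+\infty$; $\Phi^{-1}$ denotes its (generalized) inverse on $[0,\infty)$, $\Phi^{-1}(y)=\inf\{x\ge 0:\Phi(x)>y\}$. $(X,\mathcal{F},\mu)$ is a complete $\sigma$-finite measure space. $L^\Phi(\mu)$ is the space of (a.e. classes of) real-valued measurable $f$ with $\int_X\Phi(kf)\,d\mu<\infty$ for some $k>0$, a Banach space under the gauge norm $N_\Phi(f)=\inf\{k>0:\int_X\Phi(f/k)\,d\mu\le 1\}$. For $0<\mu(F)<\infty$, $N_\Phi(\chi_F)=1/\Phi^{-1}(1/\mu(F))$. $\varphi:X\to X$ is invertible (bijective with measurable inverse) and non-singular ($\mu(F)=0$ implies $\mu(\varphi^{-1}(F))=0$). A transformation $\psi$ satisfies the domination condition if there is $c>0$ with $\mu(\psi^{-1}(F))\le c\,\mu(F)$ for all $F\in\mathcal{F}$. $C_\varphi f=f\circ\varphi$, and $C_\varphi^k f=f\circ\varphi^k$ for $k\in\mathbb{Z}$. $(X,\mathcal{F},\mu,\varphi)$ is a dissipative system generated by $W$ if $W\in\mathcal{F}$, $0<\mu(W)<\infty$ and $X$ is the pairwise disjoint union of the sets $\varphi^k(W)$, $k\in\mathbb{Z}$. It is of bounded distortion if moreover there is $K>0$ such that for all $k\in\mathbb{Z}$ and all measurable $F\subseteq W$, $$\tfrac1K N_\Phi(C_\varphi^k\chi_W)N_\Phi(\chi_F)\le N_\Phi(C_\varphi^k\chi_F)N_\Phi(\chi_W)\le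 K N_\Phi(C_\varphi^k\chi_W)N_\Phi(\chi_F).$$ An invertible bounded operator $T$ on a Banach space $Y$ has the shadowing property if for every $\varepsilon>0$ there is $\delta>0$ such that for every sequence $(y_n)_{n\in\mathbb{Z}}$ in $Y$ with $\|Ty_n-y_{n+1}\|\le\delta$ for all $n\in\mathbb{Z}$ there is $y\in Y$ with $\|T^ny-y_n\|<\varepsilon$ for all $n\in\mathbb{Z}$. $\mathbb{N}_0=\{0,1,2,\dots\}$ and $-\mathbb{N}_0=\{0,-1,-2,\dots\}$. *)

theory Defs
  imports "HOL-Analysis.Analysis"
begin

text \<open>Integer iterates of a bijection of a set \<open>A\<close> onto itself; off \<open>A\<close> the values are irrelevant.\<close>

definition int_iterate :: "'b set \<Rightarrow> ('b \<Rightarrow> 'b) \<Rightarrow> int \<Rightarrow> 'b \<Rightarrow> 'b" where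
  "int_iterate A f k = (if 0 \<le> k then f ^^ nat k else inv_into A f ^^ nat (- k))"


section \<open>Operators on normed spaces given by a carrier\<close>

text \<open>The space \<open>L\<^sup>\<Phi>(\<mu>)\<close> depends on the terms \<open>\<Phi>\<close> and \<open>\<mu>\<close>, so it cannot be an instance of the
  type class of Banach spaces; a normed space is a record of its carrier and operations instead.\<close>

record 'v normed_sp =
  points :: "'v set"
  plus_sp :: "'v \<Rightarrow> 'v \<Rightarrow> 'v"
  scale_sp :: "real \<Rightarrow> 'v \<Rightarrow> 'v"
  norm_sp :: "'v \<Rightarrow> real"

definition diff_sp :: "('v, 'm) normed_sp_scheme \<Rightarrow> 'v \<Rightarrow> 'v \<Rightarrow> 'v" where
  "diff_sp Y x y = plus_sp Y x (scale_sp Y (- 1) y)"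

definition bounded_operator :: "('v, 'm) normed_sp_scheme \<Rightarrow> ('v \<Rightarrow> 'v) \<Rightarrow> bool" where
  "bounded_operator Y T \<longleftrightarrow>
     (\<forall>x\<in>points Y. T x \<in> points Y) \<and>
     (\<forall>x\<in>points Y. \<forall>y\<in>points Y. T (plus_sp Y x y) = plus_sp Y (T x) (T y)) \<and>
     (\<forall>c. \<forall>x\<in>points Y. T (scale_sp Y c x) = scale_sp Y c (T x)) \<and>
     (\<exists>B. \<forall>x\<in>points Y. norm_sp Y (T x) \<le> B * norm_sp Y x)"

definition invertible_operator :: "('v, 'm) normed_sp_scheme \<Rightarrow> ('v \<Rightarrow> 'v) \<Rightarrow> bool" where
  "invertible_operator Y T \<longleftrightarrow>
     bounded_operator Y T \<and> bij_betw T (points Y) (points Y) \<and>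
     bounded_operator Y (inv_into (points Y) T)"

definition has_shadowing_property :: "('v, 'm) normed_sp_scheme \<Rightarrow> ('v \<Rightarrow> 'v) \<Rightarrow> bool" where
  "has_shadowing_property Y T \<longleftrightarrow>
     (\<forall>\<epsilon>>0. \<exists>\<delta>>0. \<forall>y :: int \<Rightarrow> 'v.
        (\<forall>n. y n \<in> points Y) \<and> (\<forall>n. norm_sp Y (diff_sp Y (T (y n)) (y (n + 1))) \<le> \<delta>) \<longrightarrow>
        (\<exists>z\<in>points Y. \<forall>n. norm_sp Y (diff_sp Y (int_iterate (points Y) T n z) (y n)) < \<epsilon>))"


section \<open>Young's functions and Orlicz spaces\<close>

definition young_function :: "(real \<Rightarrow> ennreal) \<Rightarrow> bool" where
  "young_function \<Phi> \<longleftrightarrow>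
     (\<forall>x y t. 0 \<le> t \<and> t \<le> 1 \<longrightarrow>
        \<Phi> (t * x + (1 - t) * y) \<le> ennreal t * \<Phi> x + ennreal (1 - t) * \<Phi> y) \<and>
     (\<forall>x. \<Phi> (- x) = \<Phi> x) \<and> \<Phi> 0 = 0 \<and> (\<Phi> \<longlongrightarrow> \<infinity>) at_top"

definition young_inverse :: "(real \<Rightarrow> ennreal) \<Rightarrow> real \<Rightarrow> real" where
  "young_inverse \<Phi> y = Inf {x. 0 \<le> x \<and> \<Phi> x > ennreal y}"

text \<open>The gauge of a function; it takes the value \<open>\<infinity>\<close> if no \<open>k\<close> is admissible.\<close>

definition gauge_norm :: "'a measure \<Rightarrow> (real \<Rightarrow> ennreal) \<Rightarrow> ('a \<Rightarrow> real) \<Rightarrow> ennreal" where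
  "gauge_norm M \<Phi> f = Inf {ennreal k |k. 0 < k \<and> (\<integral>\<^sup>+x. \<Phi> (f x / k) \<partial>M) \<le> 1}"

definition orlicz_fun :: "'a measure \<Rightarrow> (real \<Rightarrow> ennreal) \<Rightarrow> ('a \<Rightarrow> real) set" where
  "orlicz_fun M \<Phi> =
     {f \<in> borel_measurable M. \<exists>k>0. (\<integral>\<^sup>+x. \<Phi> (k * f x) \<partial>M) < \<infinity>}"

definition orlicz_rel ::
    "'a measure \<Rightarrow> (real \<Rightarrow> ennreal) \<Rightarrow> (('a \<Rightarrow> real) \<times> ('a \<Rightarrow> real)) set" where
  "orlicz_rel M \<Phi> =
     {(f, g). f \<in> orlicz_fun M \<Phi> \<and> g \<in> orlicz_fun M \<Phi> \<and> (AE x in M. f x = g x)}"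

abbreviation orlicz_class ::
    "'a measure \<Rightarrow> (real \<Rightarrow> ennreal) \<Rightarrow> ('a \<Rightarrow> real) \<Rightarrow> ('a \<Rightarrow> real) set" where
  "orlicz_class M \<Phi> f \<equiv> orlicz_rel M \<Phi> `` {f}"

text \<open>The operations on equivalence classes are unions over representatives, as in
  \<^theory>\<open>HOL.Equiv_Relations\<close>; all representatives of a class have the same gauge.\<close>

definition orlicz_space ::
    "'a measure \<Rightarrow> (real \<Rightarrow> ennreal) \<Rightarrow> ('a \<Rightarrow> real) set normed_sp" where
  "orlicz_space M \<Phi> =
     \<lparr>points = orlicz_fun M \<Phi> // orlicz_rel M \<Phi>,
      plus_sp = (\<lambda>A B. \<Union>f\<in>A. \<Union>g\<in>B. orlicz_class M \<Phi> (\<lambda>x. f x + g x)),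
      scale_sp = (\<lambda>c A. \<Union>f\<in>A. orlicz_class M \<Phi> (\<lambda>x. c * f x)),
      norm_sp = (\<lambda>A. the_elem ((\<lambda>f. enn2real (gauge_norm M \<Phi> f)) ` A))\<rparr>"

definition composition_operator ::
    "'a measure \<Rightarrow> (real \<Rightarrow> ennreal) \<Rightarrow> ('a \<Rightarrow> 'a) \<Rightarrow> ('a \<Rightarrow> real) set \<Rightarrow> ('a \<Rightarrow> real) set" where
  "composition_operator M \<Phi> \<phi> A = (\<Union>f\<in>A. orlicz_class M \<Phi> (f \<circ> \<phi>))"


section \<open>Transformations of a measure space\<close>

definition invertible_transformation :: "'a measure \<Rightarrow> ('a \<Rightarrow> 'a) \<Rightarrow> bool" where
  "invertible_transformation M \<phi> \<longleftrightarrow>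
     bij_betw \<phi> (space M) (space M) \<and> \<phi> \<in> measurable M M \<and>
     inv_into (space M) \<phi> \<in> measurable M M"

definition nonsingular :: "'a measure \<Rightarrow> ('a \<Rightarrow> 'a) \<Rightarrow> bool" where
  "nonsingular M \<phi> \<longleftrightarrow>
     (\<forall>F\<in>sets M. emeasure M F = 0 \<longrightarrow> emeasure M (\<phi> -` F \<inter> space M) = 0)"

definition domination_condition :: "'a measure \<Rightarrow> ('a \<Rightarrow> 'a) \<Rightarrow> bool" where
  "domination_condition M \<psi> \<longleftrightarrow>
     (\<exists>c>0. \<forall>F\<in>sets M. emeasure M (\<psi> -` F \<inter> space M) \<le> ennreal c * emeasure M F)"

definition dissipative_system :: "'a measure \<Rightarrow> ('a \<Rightarrow> 'a) \<Rightarrow> 'a set \<Rightarrow> bool" where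
  "dissipative_system M \<phi> W \<longleftrightarrow>
     invertible_transformation M \<phi> \<and> nonsingular M \<phi> \<and>
     W \<in> sets M \<and> 0 < emeasure M W \<and> emeasure M W < \<infinity> \<and>
     disjoint_family (\<lambda>k. int_iterate (space M) \<phi> k ` W) \<and>
     (\<Union>k. int_iterate (space M) \<phi> k ` W) = space M"

definition bounded_distortion ::
    "'a measure \<Rightarrow> (real \<Rightarrow> ennreal) \<Rightarrow> ('a \<Rightarrow> 'a) \<Rightarrow> 'a set \<Rightarrow> bool" where
  "bounded_distortion M \<Phi> \<phi> W \<longleftrightarrow>
     (let N = gauge_norm M \<Phi>;
          I = (\<lambda>F. indicator F :: 'a \<Rightarrow> real);
          C = (\<lambda>k f. f \<circ> int_iterate (space M) \<phi> k)
      in \<exists>K>0. \<forall>k. \<forall>F\<in>sets M. F \<subseteq> W \<longrightarrow>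
           ennreal (1 / K) * N (C k (I W)) * N (I F) \<le> N (C k (I F)) * N (I W) \<and>
           N (C k (I F)) * N (I W) \<le> ennreal K * N (C k (I W)) * N (I F))"

end

theory Submission
  imports Defs
begin

text \<open>
Put W_k = \<phi>^k(W). The function f \<circ> \<phi>^n carries the values of f on W_k over to
W_(k-n), and a_k is the reciprocal of the gauge of \<chi>_(W_k). So on functions that are constant
on every W_k the operator is a weighted shift whose weights are the quotients of consecutive a_k.
The three alternatives say that a grows exponentially towards -\<infinity>, that it grows
exponentially towards +\<infinity>, or that it does both, each on one half of the integers. All three are
instances of one notion, \<open>grows_leftwards\<close>, applied to a and to its reflection.

Shadowing forces growth. Start with the zero function and, while the orbit moves through
W_(r-1),...,W_p, add the error \<delta> a_k \<chi>_(W_k) at each step. A shadowing orbit z has to be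
close to 0 at the time when the support is W_r, and close to \<delta>\<Sum>_(p \<le> k<r) a_k when it is
W_p. Both are statements about the one function z on W, seen through \<phi>^(-r) and
\<phi>^(-p). Bounded distortion says that a set which is small relative to W_k comes from a set
that is small relative to W; hence some point of W is typical at both times, and the values of
z there give \<Sum>_(p \<le> k<r) a_k \<le> C(a_p+a_r) with C independent of p and r
(\<open>shadowing_imp_endpoint_bound\<close>). A positive sequence of that kind with bounded quotients falls under
one of the three alternatives (\<open>endpoint_bound_imp_exponential_growth\<close>): sums over centred intervals
grow geometrically with the radius, so for a suitable N every a_k is at most half of a_(k-N) or
of a_(k+N), and once a doubles to the right it keeps doing so.

Growth forces shadowing. Bounded distortion says something about indicator functions only,
not about gauges of general functions, but together with growth it bounds measures. If
a_k \<le> q^n a_(k-n), concavity of \<Phi>^(-1) turns the comparison of gauges of indicators into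
\<mu>(\<phi>^(-n)F) \<le> K^2q^n\<mu>(F) for all measurable F \<subseteq> W_k
(\<open>measure_contraction_piece\<close>). This sums over k, so composition with \<phi>^n contracts the
modular \<integral>\<Phi>(f) d\<mu>. To pass from modulars to gauges one needs \<Phi>(2x) \<le> B \<Phi>(x). Growth
supplies this too (\<open>growth_imp_doubling\<close>): 1/\<mu>(W_k) changes by a bounded factor from one k to the
next, while \<Phi>^(-1) doubles along it within boundedly many steps. Hence the operator contracts
the functions that live on the left part of the system, its inverse contracts those on the right
part, and the errors of a pseudo-orbit are corrected by two convergent series, one running forwards
and one backwards (\<open>splitting_imp_shadowing\<close>).

If \<Phi> is infinite off 0, then all a_k vanish and the space is trivial, so that both sides of
the equivalence hold.
\<close>

section \<open>Exponential growth of two-sided sequences\<close>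

text \<open>
Evaluated at a reflected sequence \<open>a \<circ> uminus\<close> this is growth to the right, so statements
about one direction of time suffice.
\<close>

definition grows_leftwards :: "(int \<Rightarrow> real) \<Rightarrow> int set \<Rightarrow> bool" where
  "grows_leftwards a I \<longleftrightarrow>
     (\<exists>q n0. 0 < q \<and> q < 1 \<and> (\<forall>n\<ge>n0. \<forall>k\<in>I. a k \<le> q ^ n * a (k - int n)))"

lemma limsup_SUP_root_less_1_iff:
  fixes u :: "nat \<Rightarrow> 'i \<Rightarrow> real"
  assumes pos: "\<And>n k. k \<in> I \<Longrightarrow> 0 < u n k"
  shows "limsup (\<lambda>n. SUP k\<in>I. ereal (u n k powr (1 / real n))) < 1 \<longleftrightarrow>
    (\<exists>q n0. 0 < q \<and> q < 1 \<and> (\<forall>n\<ge>n0. \<forall>k\<in>I. u n k \<le> q ^ n))" (is "?L < 1 \<longleftrightarrow> ?R")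
proof
  assume "?L < 1"
  then obtain r where r: "?L < ereal r" "ereal r < 1" using ereal_dense2 by blast
  define q where "q = max r (1/2)"
  have q: "0 < q" "q < 1" using r by (auto simp: q_def)
  have "?L < ereal q" using less_le_trans[OF r(1), of "ereal q"] by (simp add: q_def)
  then have "\<forall>\<^sub>F n in sequentially. (SUP k\<in>I. ereal (u n k powr (1 / real n))) < ereal q"
    by (rule Limsup_lessD)
  then obtain n0 where n0: "\<And>n. n \<ge> n0 \<Longrightarrow> (SUP k\<in>I. ereal (u n k powr (1 / real n))) < ereal q"
    by (auto simp: eventually_sequentially)
  have "u n k \<le> q ^ n" if "n \<ge> Suc n0" "k \<in> I" for n k
  proof -
    have "ereal (u n k powr (1 / real n)) \<le> (SUP k\<in>I. ereal (u n k powr (1 / real n)))"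
      using that by (intro SUP_upper)
    also have "\<dots> < ereal q" using n0[of n] that by simp
    finally have le: "u n k powr (1 / real n) \<le> q" by simp
    have "u n k = (u n k powr (1 / real n)) powr real n"
      using pos[OF that(2), of n] that(1) by (simp add: powr_powr)
    also have "\<dots> \<le> q powr real n" using le by (intro powr_mono2) auto
    also have "\<dots> = q ^ n" using q by (simp add: powr_realpow)
    finally show ?thesis .
  qed
  with q show ?R by blast
next
  assume ?R
  then obtain q n0 where q: "0 < q" "q < 1" and le: "\<And>n k. n \<ge> n0 \<Longrightarrow> k \<in> I \<Longrightarrow> u n k \<le> q ^ n"
    by blast
  have "u n k powr (1 / real n) \<le> q" if "n \<ge> Suc n0" "k \<in> I" for n k
  proof -
    have "u n k powr (1 / real n) \<le> (q ^ n) powr (1 / real n)"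
      using le[of n k] that pos[OF that(2), of n] by (intro powr_mono2) auto
    also have "q ^ n = q powr real n" using q by (simp add: powr_realpow)
    also have "\<dots> powr (1 / real n) = q" using q that by (simp add: powr_powr)
    finally show ?thesis .
  qed
  then have "\<forall>\<^sub>F n in sequentially. (SUP k\<in>I. ereal (u n k powr (1 / real n))) \<le> ereal q"
    unfolding eventually_sequentially by (intro exI[of _ "Suc n0"]) (auto intro!: SUP_least)
  then have "?L \<le> ereal q" by (rule Limsup_bounded)
  also have "ereal q < 1" using q by simp
  finally show "?L < 1" .
qed

lemma liminf_INF_root_greater_1_iff:
  fixes u :: "nat \<Rightarrow> 'i \<Rightarrow> real"
  assumes pos: "\<And>n k. k \<in> I \<Longrightarrow> 0 < u n k"
  shows "liminf (\<lambda>n. INF k\<in>I. ereal (u n k powr (1 / real n))) > 1 \<longleftrightarrow>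
    (\<exists>q n0. 0 < q \<and> q < 1 \<and> (\<forall>n\<ge>n0. \<forall>k\<in>I. 1 \<le> q ^ n * u n k))" (is "1 < ?L \<longleftrightarrow> ?R")
proof
  assume "1 < ?L"
  then obtain r where r: "ereal r < ?L" "1 < ereal r" using ereal_dense2 by blast
  have r1: "1 < r" using r by simp
  have "\<forall>\<^sub>F n in sequentially. ereal r < (INF k\<in>I. ereal (u n k powr (1 / real n)))"
    using r(1) by (rule less_LiminfD)
  then obtain n0 where n0: "\<And>n. n \<ge> n0 \<Longrightarrow> ereal r < (INF k\<in>I. ereal (u n k powr (1 / real n)))"
    by (auto simp: eventually_sequentially)
  have "1 \<le> (1 / r) ^ n * u n k" if "n \<ge> Suc n0" "k \<in> I" for n k
  proof -
    have "ereal r < (INF k\<in>I. ereal (u n k powr (1 / real n)))" using n0[of n] that by simp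
    also have "\<dots> \<le> ereal (u n k powr (1 / real n))"
      using that by (intro INF_lower)
    finally have le: "r \<le> u n k powr (1 / real n)" by simp
    have "r ^ n = r powr real n" using r1 by (simp add: powr_realpow)
    also have "\<dots> \<le> (u n k powr (1 / real n)) powr real n" using le r1 by (intro powr_mono2) auto
    also have "\<dots> = u n k"
      using pos[OF that(2), of n] that(1) by (simp add: powr_powr)
    finally show ?thesis using r1 by (simp add: field_simps)
  qed
  moreover have "0 < 1 / r" "1 / r < 1" using r1 by auto
  ultimately show ?R by blast
next
  assume ?R
  then obtain q n0 where q: "0 < q" "q < 1"
    and le: "\<And>n k. n \<ge> n0 \<Longrightarrow> k \<in> I \<Longrightarrow> 1 \<le> q ^ n * u n k"
    by blast
  have "1 / q \<le> u n k powr (1 / real n)" if "n \<ge> Suc n0" "k \<in> I" for n k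
  proof -
    have "1 / q = ((1 / q) ^ n) powr (1 / real n)"
    proof -
      have "(1 / q) ^ n = (1 / q) powr real n" using q by (simp add: powr_realpow)
      then show ?thesis using q that by (simp add: powr_powr)
    qed
    also have "\<dots> \<le> u n k powr (1 / real n)"
      using le[of n k] that q by (intro powr_mono2) (auto simp: field_simps)
    finally show ?thesis .
  qed
  then have "\<forall>\<^sub>F n in sequentially. ereal (1 / q) \<le> (INF k\<in>I. ereal (u n k powr (1 / real n)))"
    unfolding eventually_sequentially by (intro exI[of _ "Suc n0"]) (auto intro!: INF_greatest)
  then have "ereal (1 / q) \<le> ?L" by (rule Liminf_bounded)
  moreover have "1 < ereal (1 / q)" using q by simp
  ultimately show "1 < ?L" by (rule less_le_trans[rotated])
qed

text \<open>
Halving once in every \<open>N\<close> steps is geometric decay in the number of steps, with ratio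
2^(-1/N) and a factor 2 for the incomplete last round.
\<close>

lemma half_power_div_le:
  assumes "0 < N"
  shows "\<exists>\<theta>::real. 0 < \<theta> \<and> \<theta> < 1 \<and> (\<forall>j. (1/2) ^ (j div N) \<le> 2 * \<theta> ^ j)"
proof (intro exI conjI allI)
  let ?t = "root N (1/2) :: real"
  show t: "0 < ?t" "?t < 1" using assms by auto
  fix j
  have tN: "?t ^ N = 1/2" using assms by simp
  have "?t ^ j = ?t ^ (N * (j div N) + j mod N)" by simp
  also have "\<dots> = (1/2) ^ (j div N) * ?t ^ (j mod N)"
    by (simp only: power_add power_mult tN)
  also have "\<dots> \<ge> (1/2) ^ (j div N) * ?t ^ N"
    using t assms by (intro mult_left_mono power_decreasing) (auto simp: less_imp_le)
  finally show "(1/2) ^ (j div N) \<le> 2 * ?t ^ j" using tN by simp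
qed

text \<open>
A constant factor does no harm: it is absorbed by the slightly larger ratio (1+q)/2 from some
index on.
\<close>

lemma grows_leftwardsI:
  assumes pos: "\<And>k. 0 \<le> a k" and q: "0 < q" "q < 1"
    and le: "\<And>n k. n \<ge> n0 \<Longrightarrow> k \<in> I \<Longrightarrow> a k \<le> C * q ^ n * a (k - int n)"
  shows "grows_leftwards a I"
proof -
  define p where "p = (1 + q) / 2"
  have p: "0 < p" "p < 1" "q < p" using q by (auto simp: p_def)
  have "(\<lambda>n. \<bar>C\<bar> * (q / p) ^ n) \<longlonglongrightarrow> \<bar>C\<bar> * 0"
    using p q by (intro tendsto_intros LIMSEQ_realpow_zero) auto
  then have "\<forall>\<^sub>F n in sequentially. \<bar>C\<bar> * (q / p) ^ n < 1"
    by (rule order_tendstoD) auto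
  then obtain n1 where n1: "\<And>n. n \<ge> n1 \<Longrightarrow> \<bar>C\<bar> * (q / p) ^ n < 1"
    by (auto simp: eventually_sequentially)
  have "a k \<le> p ^ n * a (k - int n)" if "n \<ge> max n0 n1" "k \<in> I" for n k
  proof -
    have "\<bar>C\<bar> * q ^ n \<le> p ^ n" using n1[of n] that p by (simp add: power_divide field_simps)
    then have "C * q ^ n \<le> p ^ n"
      using q order_trans[OF mult_right_mono[OF abs_ge_self[of C], of "q ^ n"]] by simp
    then have "C * q ^ n * a (k - int n) \<le> p ^ n * a (k - int n)"
      using pos by (intro mult_right_mono)
    with le[of n k] that show ?thesis by linarith
  qed
  with p show ?thesis unfolding grows_leftwards_def by blast
qed

lemma ratio_bound_iterate:
  fixes a :: "int \<Rightarrow> real"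
  assumes "1 \<le> R" "\<And>k. a k \<le> R * a (k - 1)"
  shows "a k \<le> R ^ r * a (k - int r)"
proof (induction r)
  case (Suc r)
  have "R ^ r * a (k - int r) \<le> R ^ r * (R * a (k - int r - 1))"
    using assms by (intro mult_left_mono) auto
  with Suc show ?case by (simp add: algebra_simps)
qed simp

lemma grows_leftwards_of_step:
  fixes a :: "int \<Rightarrow> real"
  assumes pos: "\<And>k. 0 < a k" and R: "1 \<le> R" "\<And>k. a k \<le> R * a (k - 1)" and N: "0 < N"
    and dbl: "\<And>k. k \<in> I \<Longrightarrow> 2 * a k \<le> a (k - int N)"
    and down: "\<And>k n. k \<in> I \<Longrightarrow> k - int n \<in> I"
  shows "\<exists>C q. 0 < q \<and> q < 1 \<and> 0 < C \<and> (\<forall>n. \<forall>k\<in>I. a k \<le> C * q ^ n * a (k - int n))"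
proof -
  obtain \<theta> :: real where \<theta>: "0 < \<theta>" "\<theta> < 1" "\<And>j. (1/2) ^ (j div N) \<le> 2 * \<theta> ^ j"
    using half_power_div_le[OF N] by blast
  have iter: "a k \<le> (1/2) ^ j * a (k - int (j * N))" if "k \<in> I" for k j
  proof (induction j)
    case (Suc j)
    have e: "k - int (Suc j * N) = k - int (j * N) - int N" by simp
    have "2 * a (k - int (j * N)) \<le> a (k - int (j * N) - int N)" using dbl down that by blast
    then have "a (k - int (j * N)) \<le> (1/2) * a (k - int (Suc j * N))" unfolding e by simp
    then have "(1/2) ^ j * a (k - int (j * N)) \<le> (1/2) ^ j * ((1/2) * a (k - int (Suc j * N)))"
      by (intro mult_left_mono) auto
    with Suc have "a k \<le> (1/2) ^ j * ((1/2) * a (k - int (Suc j * N)))" by (rule order_trans)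
    then show ?case by (simp only: power_Suc mult_ac)
  qed simp
  note step = ratio_bound_iterate[of R a, OF R]
  have "a k \<le> (2 * R ^ N) * \<theta> ^ n * a (k - int n)" if k: "k \<in> I" for n k
  proof -
    define j r where "j = n div N" and "r = n mod N"
    have n: "n = j * N + r" by (simp add: j_def r_def)
    have "a k \<le> (1/2) ^ j * a (k - int (j * N))" by (rule iter[OF k])
    also have "\<dots> \<le> (1/2) ^ j * (R ^ r * a (k - int (j * N) - int r))"
      by (intro mult_left_mono step) auto
    also have "\<dots> = (1/2) ^ j * R ^ r * a (k - int n)" by (simp add: n algebra_simps)
    also have "\<dots> \<le> (2 * \<theta> ^ n) * R ^ N * a (k - int n)"
      using \<theta> R N pos[of "k - int n"] unfolding j_def
      by (intro mult_mono \<theta>(3) power_increasing) (auto simp: r_def less_imp_le)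
    finally show ?thesis by (simp add: mult_ac)
  qed
  then show ?thesis using \<theta> R by (intro exI[of _ "2 * R ^ N"] exI[of _ \<theta>]) auto
qed

text \<open>
For the sum s_j over the interval of radius j around k, the hypothesis reads
s_j \<le> B(s_j-s_(j-1)). Hence s_j grows at least like (B/(B-1))^j, and the hypothesis in the form
s_N \<le> B(a_(k-N)+a_(k+N)) shows that one of the two endpoints is large compared with a_k.
\<close>

lemma endpoint_bound_imp_doubling:
  fixes a :: "int \<Rightarrow> real"
  assumes pos: "\<And>k. 0 < a k"
    and ends: "\<And>p r. p \<le> r \<Longrightarrow> (\<Sum>k\<in>{p..<r}. a k) \<le> C * (a p + a r)"
  shows "\<exists>N>0. \<forall>k. 2 * a k \<le> a (k - int N) \<or> 2 * a k \<le> a (k + int N)"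
proof -
  define B where "B = \<bar>C\<bar> + 2"
  have B: "B > 1" by (simp add: B_def)
  define \<rho> where "\<rho> = B / (B - 1)"
  have \<rho>: "\<rho> > 1" using B by (simp add: \<rho>_def field_simps)
  have "\<exists>n. 4 * B < \<rho> ^ n" using real_arch_pow[OF \<rho>] by blast
  then obtain N0 where N0: "4 * B < \<rho> ^ N0" ..
  define N where "N = Suc N0"
  have "\<rho> ^ N0 \<le> \<rho> ^ N" unfolding N_def using \<rho> by (intro power_increasing) auto
  with N0 have N: "4 * B < \<rho> ^ N" "N > 0" by (auto simp: N_def)
  show ?thesis
  proof (intro exI conjI allI, rule N)
    fix k
    define s where "s j = (\<Sum>i\<in>{k - int j..k + int j}. a i)" for j
    have s_ends: "s j \<le> B * (a (k - int j) + a (k + int j))" for j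
    proof -
      have "{k - int j..k + int j} = insert (k + int j) {k - int j..<k + int j}" by auto
      then have "s j = a (k + int j) + (\<Sum>i\<in>{k - int j..<k + int j}. a i)"
        unfolding s_def by (simp add: sum.insert)
      also have "\<dots> \<le> a (k + int j) + C * (a (k - int j) + a (k + int j))"
        by (intro add_left_mono ends) auto
      also have "\<dots> \<le> 1 * (a (k - int j) + a (k + int j)) + \<bar>C\<bar> * (a (k - int j) + a (k + int j))"
        using pos[of "k - int j"] pos[of "k + int j"] by (intro add_mono mult_right_mono) auto
      also have "\<dots> \<le> B * (a (k - int j) + a (k + int j))"
        unfolding B_def using pos[of "k - int j"] pos[of "k + int j"] by (simp add: algebra_simps)
      finally show ?thesis .
    qed
    have grow: "\<rho> ^ j * a k \<le> s j" for j
    proof (induction j)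
      case 0 then show ?case by (simp add: s_def)
    next
      case (Suc j)
      have "{k - int (Suc j)..k + int (Suc j)} =
          insert (k - int (Suc j)) (insert (k + int (Suc j)) {k - int j..k + int j})" by auto
      then have "s (Suc j) = a (k - int (Suc j)) + a (k + int (Suc j)) + s j"
        unfolding s_def by (simp add: sum.insert)
      with s_ends[of "Suc j"] have "s (Suc j) \<le> B * (s (Suc j) - s j)" by simp
      then have "\<rho> * s j \<le> s (Suc j)" using B by (simp add: \<rho>_def field_simps)
      moreover have "\<rho> * (\<rho> ^ j * a k) \<le> \<rho> * s j" using Suc \<rho> by (intro mult_left_mono) auto
      ultimately show ?case by (simp add: mult_ac)
    qed
    have "4 * B * a k \<le> \<rho> ^ N * a k" using N pos[of k] by (intro mult_right_mono) auto
    also have "\<dots> \<le> B * (a (k - int N) + a (k + int N))" using grow[of N] s_ends[of N] by linarith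
    finally have "4 * a k \<le> a (k - int N) + a (k + int N)" using B by (simp add: mult.assoc mult.left_commute)
    then show "2 * a k \<le> a (k - int N) \<or> 2 * a k \<le> a (k + int N)" by linarith
  qed
qed

text \<open>
The two alternatives at k propagate: if a does not double from k to k+N, then it doubles from
k to k-N, and this in turn excludes doubling from k-N back to k.
\<close>

lemma not_doubling_right_imp_left:
  fixes a :: "int \<Rightarrow> real"
  assumes pos: "\<And>k. 0 < a k"
    and dbl: "\<And>k. 2 * a k \<le> a (k - int N) \<or> 2 * a k \<le> a (k + int N)"
    and no: "\<not> 2 * a k \<le> a (k + int N)"
  shows "2 ^ j * a k \<le> a (k - int (j * N)) \<and> \<not> 2 * a (k - int (j * N)) \<le> a (k - int (j * N) + int N)"
proof (induction j)
  case 0 then show ?case using no by simp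
next
  case (Suc j)
  define m where "m = k - int (j * N)"
  have m: "2 * a m \<le> a (m - int N)" using Suc dbl[of m] by (auto simp: m_def)
  have e: "k - int (Suc j * N) = m - int N" and e': "m - int N + int N = m"
    by (simp_all add: m_def algebra_simps)
  have "\<not> 2 * a (m - int N) \<le> a m" using m pos[of m] by linarith
  moreover have "2 ^ Suc j * a k \<le> a (m - int N)" using m Suc by (simp add: m_def)
  ultimately show ?case unfolding e e' by (intro conjI)
qed

text \<open>
The failure at k_0 makes a double to the left along k_0-N\<nat>; bounded quotients are
needed to reach the other residue classes modulo N. If doubling to the left failed at some k far
to the left of k_0, then a would double to the right all the way from k up to k_0, and both
estimates together would make 4^j bounded, where j is the number of steps between k and k_0.
\<close>

lemma failed_right_doubling_imp_grows_leftwards: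
  fixes a :: "int \<Rightarrow> real"
  assumes pos: "\<And>k. 0 < a k" and N: "0 < N"
    and R: "1 \<le> R" "\<And>k. a (k - 1) \<le> R * a k" "\<And>k. a k \<le> R * a (k - 1)"
    and dbl: "\<And>k. 2 * a k \<le> a (k - int N) \<or> 2 * a k \<le> a (k + int N)"
    and no: "\<not> 2 * a k0 \<le> a (k0 + int N)"
  shows "grows_leftwards a {..0}"
proof -
  have stepR: "a (k - int r) \<le> R ^ r * a k" for k r
  proof (induction r)
    case (Suc r)
    have "a (k - int (Suc r)) \<le> R * a (k - int r)" using R(2)[of "k - int r"] by (simp add: algebra_simps)
    also have "\<dots> \<le> R * (R ^ r * a k)" using Suc R by (intro mult_left_mono) auto
    finally show ?case by simp
  qed simp
  note stepL = ratio_bound_iterate[of R a, OF R(1) R(3)]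
  have left: "2 ^ j * a k0 \<le> a (k0 - int (j * N))" for j
    using not_doubling_right_imp_left[of a N k0 j] pos dbl no by blast
  \<comment> \<open>Doubling to the left holds at every point far enough to the left.\<close>
  have ex: "\<exists>T. \<forall>k\<le>k0 - int T. 2 * a k \<le> a (k - int N)"
  proof -
    obtain j0 where j0: "(R ^ N * R ^ N) < 2 ^ j0" using real_arch_pow[of 2] by auto
    have "2 * a k \<le> a (k - int N)" if k: "k \<le> k0 - int (j0 * N)" for k
    proof (rule ccontr)
      assume "\<not> 2 * a k \<le> a (k - int N)"
      then have no': "\<not> 2 * (a \<circ> uminus) (-k) \<le> (a \<circ> uminus) (-k + int N)" by simp
      define j r where "j = nat (k0 - k) div N" and "r = nat (k0 - k) mod N"
      have "nat (k0 - k) = j * N + r" by (simp add: j_def r_def)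
      then have k0: "k0 - k = int (j * N) + int r" using k by linarith
      have "j0 * N \<le> nat (k0 - k)" using k by linarith
      then have jj: "j0 \<le> j" unfolding j_def using N by (simp add: less_eq_div_iff_mult_less_eq)
      have r: "r < N" using N by (simp add: r_def)
      have "\<And>i. 2 * (a \<circ> uminus) i \<le> (a \<circ> uminus) (i - int N) \<or> 2 * (a \<circ> uminus) i \<le> (a \<circ> uminus) (i + int N)"
      proof -
        fix i
        show "2 * (a \<circ> uminus) i \<le> (a \<circ> uminus) (i - int N) \<or> 2 * (a \<circ> uminus) i \<le> (a \<circ> uminus) (i + int N)"
          using dbl[of "- i"] by (auto simp: algebra_simps)
      qed
      from not_doubling_right_imp_left[of "a \<circ> uminus" N "-k" j, OF _ this no'] pos
      have "2 ^ j * a k \<le> a (k + int (j * N))" by (auto simp: algebra_simps)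
      also have "k + int (j * N) = k0 - int r" using k0 by simp
      also have "a (k0 - int r) \<le> R ^ N * a k0"
      proof -
        have "R ^ r * a k0 \<le> R ^ N * a k0"
          using R r pos[of k0] by (intro mult_right_mono power_increasing) auto
        with stepR[of k0 r] show ?thesis by linarith
      qed
      finally have A: "2 ^ j * a k \<le> R ^ N * a k0" .
      have "2 ^ j * a k0 \<le> a (k0 - int (j * N))" by (rule left)
      also have "k0 - int (j * N) = k + int r" using k0 by simp
      also have "a (k + int r) \<le> R ^ r * a k" using stepL[of "k + int r" r] by simp
      also have "\<dots> \<le> R ^ N * a k" using R r pos[of k] by (intro mult_right_mono power_increasing) auto
      finally have B: "2 ^ j * a k0 \<le> R ^ N * a k" .
      have "2 ^ j * (2 ^ j * a k0) \<le> 2 ^ j * (R ^ N * a k)" using B by (intro mult_left_mono) auto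
      also have "\<dots> = R ^ N * (2 ^ j * a k)" by simp
      also have "\<dots> \<le> R ^ N * (R ^ N * a k0)" using A R by (intro mult_left_mono) auto
      finally have "(2 ^ j * 2 ^ j) * a k0 \<le> (R ^ N * R ^ N) * a k0" by (simp add: mult_ac)
      then have "(2::real) ^ j * 2 ^ j \<le> R ^ N * R ^ N" using pos[of k0] by simp
      moreover have "(2::real) ^ j0 \<le> 2 ^ j" using jj by (intro power_increasing) auto
      moreover have "(1::real) * 2 ^ j \<le> 2 ^ j * 2 ^ j" by (intro mult_right_mono) auto
      ultimately show False using j0 by linarith
    qed
    then show ?thesis by blast
  qed
  then obtain T where T: "\<And>k. k \<le> k0 - int T \<Longrightarrow> 2 * a k \<le> a (k - int N)" by blast
  define t where "t = nat \<bar>k0 - int T\<bar>"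
  have t: "- int t \<le> k0 - int T" by (simp add: t_def)
  obtain C q where q: "0 < q" "q < 1" "0 < C"
    and le: "\<And>n k. k \<le> k0 - int T \<Longrightarrow> a k \<le> C * q ^ n * a (k - int n)"
    using grows_leftwards_of_step[of a R N "{..k0 - int T}"] pos N R T by auto
  show ?thesis
  proof (rule grows_leftwardsI[of a q t "{..0}" "R ^ t * C / q ^ t"])
    fix n k assume n: "t \<le> n" and k: "k \<in> {..0::int}"
    have "a k \<le> R ^ t * a (k - int t)" by (rule stepL)
    also have "\<dots> \<le> R ^ t * (C * q ^ (n - t) * a (k - int t - int (n - t)))"
      using k t R by (intro mult_left_mono le) auto
    also have "\<dots> = R ^ t * C / q ^ t * q ^ n * a (k - int n)"
      using n q by (simp add: power_diff algebra_simps of_nat_diff)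
    finally show "a k \<le> R ^ t * C / q ^ t * q ^ n * a (k - int n)" .
  qed (use q pos in \<open>auto intro: less_imp_le\<close>)
qed

text \<open>
Either a always doubles to the left, or always to the right, or each fails somewhere. In the last
case the failure of one kind yields growth on the opposite half line.
\<close>

theorem endpoint_bound_imp_exponential_growth:
  fixes a :: "int \<Rightarrow> real"
  assumes pos: "\<And>k. 0 < a k"
    and R: "1 \<le> R" "\<And>k. a (k - 1) \<le> R * a k" "\<And>k. a k \<le> R * a (k - 1)"
    and ends: "\<And>p r. p \<le> r \<Longrightarrow> (\<Sum>k\<in>{p..<r}. a k) \<le> C * (a p + a r)"
  shows "grows_leftwards a UNIV \<or> grows_leftwards (a \<circ> uminus) UNIV \<or>
    grows_leftwards a {..0} \<and> grows_leftwards (a \<circ> uminus) {..0}"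
proof -
  obtain N where N: "N > 0" and dbl: "\<And>k. 2 * a k \<le> a (k - int N) \<or> 2 * a k \<le> a (k + int N)"
    using endpoint_bound_imp_doubling[of a C] pos ends by blast
  have R': "(a \<circ> uminus) (k - 1) \<le> R * (a \<circ> uminus) k" "(a \<circ> uminus) k \<le> R * (a \<circ> uminus) (k - 1)" for k
    using R(2)[of "- k + 1"] R(3)[of "- k + 1"] by (simp_all add: algebra_simps)
  have dbl': "2 * (a \<circ> uminus) i \<le> (a \<circ> uminus) (i - int N) \<or> 2 * (a \<circ> uminus) i \<le> (a \<circ> uminus) (i + int N)" for i
    using dbl[of "- i"] by (auto simp: algebra_simps)
  have growsI: "grows_leftwards b UNIV"
    if b: "\<And>k. 0 < b k" "\<And>k. b k \<le> R * b (k - 1)" "\<And>k. 2 * b k \<le> b (k - int N)" for b :: "int \<Rightarrow> real"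
  proof -
    obtain C q where "0 < q" "q < 1" "0 < C" "\<And>n k. b k \<le> C * q ^ n * b (k - int n)"
      using grows_leftwards_of_step[of b R N UNIV, OF b(1) R(1) b(2) N b(3)] by auto
    then show ?thesis using b(1) by (intro grows_leftwardsI[of b q 0 UNIV C]) (auto intro: less_imp_le)
  qed
  show ?thesis
  proof (cases "\<forall>k. 2 * a k \<le> a (k - int N)")
    case True
    then show ?thesis using growsI[of a] pos R by blast
  next
    case False
    then obtain k1 where k1: "\<not> 2 * (a \<circ> uminus) (- k1) \<le> (a \<circ> uminus) (- k1 + int N)" by (auto simp: algebra_simps)
    show ?thesis
    proof (cases "\<forall>k. 2 * a k \<le> a (k + int N)")
      case True
      then have "2 * (a \<circ> uminus) k \<le> (a \<circ> uminus) (k - int N)" for k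
        using True[rule_format, of "- k"] by (simp add: algebra_simps)
      then show ?thesis using growsI[of "a \<circ> uminus"] pos R' by auto
    next
      case False
      then obtain k0 where k0: "\<not> 2 * a k0 \<le> a (k0 + int N)" by blast
      have "grows_leftwards a {..0}" using failed_right_doubling_imp_grows_leftwards[of a N R k0] pos N R dbl k0 by blast
      moreover have "grows_leftwards (a \<circ> uminus) {..0}"
        using failed_right_doubling_imp_grows_leftwards[of "a \<circ> uminus" N R "- k1"] pos N R(1) R' dbl' k1 by auto
      ultimately show ?thesis by blast
    qed
  qed
qed

section \<open>The three growth conditions\<close>

text \<open>
Taking n-th roots turns uniform geometric bounds into bounds for upper and lower limits. Positivity
of a matters: for a=0 the quotients are 0 by convention.
\<close>

lemma growth_conditions_iff:
  fixes a :: "int \<Rightarrow> real"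
  assumes pos: "\<And>k. 0 < a k"
  shows "limsup (\<lambda>n. SUP k. ereal ((a (k + int n) / a k) powr (1 / real n))) < 1 \<longleftrightarrow>
      grows_leftwards a UNIV" (is ?C)
    and "liminf (\<lambda>n. INF k. ereal ((a (k + int n) / a k) powr (1 / real n))) > 1 \<longleftrightarrow>
      grows_leftwards (a \<circ> uminus) UNIV" (is ?D)
    and "limsup (\<lambda>n. SUP k\<in>{..0}. ereal ((a k / a (k - int n)) powr (1 / real n))) < 1 \<longleftrightarrow>
      grows_leftwards a {..0}" (is ?G)
    and "liminf (\<lambda>n. INF k\<in>{0..}. ereal ((a (k + int n) / a k) powr (1 / real n))) > 1 \<longleftrightarrow>
      grows_leftwards (a \<circ> uminus) {..0}" (is ?H)
proof -
  have div_le: "a k / a l \<le> r \<longleftrightarrow> a k \<le> r * a l" for k l r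
    using pos[of l] by (simp add: pos_divide_le_eq)
  have le_div: "1 \<le> r * (a l / a k) \<longleftrightarrow> a k \<le> r * a l" for k l r
    using pos[of k] by (simp add: pos_le_divide_eq)
  have posdiv: "0 < a k / a l" for k l using pos by simp
  have shift: "(\<forall>k. P k) \<longleftrightarrow> (\<forall>k. P (k - int n))" for P n
    by (metis add_diff_cancel_right')
  have minus: "(\<forall>k. P k) \<longleftrightarrow> (\<forall>k. P (- k))" for P :: "int \<Rightarrow> bool" by (metis minus_minus)
  have minus0: "(\<forall>k\<in>{0..}. P k) \<longleftrightarrow> (\<forall>k\<in>{..0}. P (- k))" for P :: "int \<Rightarrow> bool"
    by (metis atLeast_iff atMost_iff minus_minus neg_0_le_iff_le)
  have "(\<forall>k\<in>UNIV. a (k + int n) / a k \<le> r) \<longleftrightarrow> (\<forall>k\<in>UNIV. a k \<le> r * a (k - int n))" for n r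
    unfolding div_le ball_UNIV by (subst shift[of _ n]) simp
  then show ?C
    unfolding grows_leftwards_def by (subst limsup_SUP_root_less_1_iff) (auto simp: posdiv)
  have "(\<forall>k\<in>UNIV. 1 \<le> r * (a (k + int n) / a k)) \<longleftrightarrow>
      (\<forall>k\<in>UNIV. (a \<circ> uminus) k \<le> r * (a \<circ> uminus) (k - int n))" for n r
    unfolding le_div ball_UNIV by (subst minus) (simp add: algebra_simps)
  then show ?D
    unfolding grows_leftwards_def by (subst liminf_INF_root_greater_1_iff) (simp_all only: posdiv)
  show ?G
    unfolding grows_leftwards_def by (subst limsup_SUP_root_less_1_iff) (simp_all only: posdiv div_le)
  have "(\<forall>k\<in>{0..}. 1 \<le> r * (a (k + int n) / a k)) \<longleftrightarrow>
      (\<forall>k\<in>{..0}. (a \<circ> uminus) k \<le> r * (a \<circ> uminus) (k - int n))" for n r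
    unfolding le_div by (subst minus0) (simp add: algebra_simps)
  then show ?H
    unfolding grows_leftwards_def by (subst liminf_INF_root_greater_1_iff) (simp_all only: posdiv)
qed

section \<open>Young's functions and modulars\<close>

locale young_fn =
  fixes \<Phi> :: "real \<Rightarrow> ennreal"
  assumes young: "young_function \<Phi>"
begin

lemma convex:
  "0 \<le> t \<Longrightarrow> t \<le> 1 \<Longrightarrow> \<Phi> (t * x + (1 - t) * y) \<le> ennreal t * \<Phi> x + ennreal (1 - t) * \<Phi> y"
  using young by (auto simp: young_function_def)

lemma even: "\<Phi> (- x) = \<Phi> x" and at_zero [simp]: "\<Phi> 0 = 0" and tends_to_infinity: "(\<Phi> \<longlongrightarrow> \<infinity>) at_top"
  using young by (auto simp: young_function_def)

lemma apply_abs [simp]: "\<Phi> \<bar>x\<bar> = \<Phi> x"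
  using even by (cases "x \<ge> 0") auto

lemma scale_le: "0 \<le> t \<Longrightarrow> t \<le> 1 \<Longrightarrow> \<Phi> (t * x) \<le> ennreal t * \<Phi> x"
  using convex[of t x 0] by simp

lemma mono_abs:
  assumes "\<bar>x\<bar> \<le> \<bar>y\<bar>" shows "\<Phi> x \<le> \<Phi> y"
proof (cases "y = 0")
  case False
  have "\<Phi> \<bar>x\<bar> = \<Phi> ((\<bar>x\<bar> / \<bar>y\<bar>) * \<bar>y\<bar>)" using False by simp
  also have "\<dots> \<le> ennreal (\<bar>x\<bar> / \<bar>y\<bar>) * \<Phi> \<bar>y\<bar>" using assms False by (intro scale_le) auto
  also have "\<dots> \<le> 1 * \<Phi> \<bar>y\<bar>" using assms False by (intro mult_right_mono) auto
  finally show ?thesis by simp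
qed (use assms in auto)

lemma mono_nonneg: "0 \<le> x \<Longrightarrow> x \<le> y \<Longrightarrow> \<Phi> x \<le> \<Phi> y"
  by (rule mono_abs) auto

lemma exceeds: "\<exists>x>b. ennreal y < \<Phi> x"
proof -
  have "\<forall>\<^sub>F x in at_top. ennreal y < \<Phi> x" by (rule order_tendstoD(1)[OF tends_to_infinity]) simp
  then have "\<forall>\<^sub>F x in at_top. ennreal y < \<Phi> x \<and> b < x"
    using eventually_gt_at_top by (rule eventually_conj)
  then show ?thesis using eventually_happens'[OF trivial_limit_at_top_linorder] by blast
qed

text \<open>
Sublevel sets of an even function that is monotone on the positive half line are intervals.
\<close>

lemma young_measurable [measurable]: "\<Phi> \<in> borel_measurable borel"
proof (rule borel_measurableI_le)
  fix y
  have "is_interval {x. \<Phi> x \<le> y}"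
    unfolding is_interval_1
  proof (intro ballI allI impI)
    fix a b x assume a: "a \<in> {x. \<Phi> x \<le> y}" and b: "b \<in> {x. \<Phi> x \<le> y}" and "a \<le> x \<and> x \<le> b"
    then have "\<bar>x\<bar> \<le> \<bar>a\<bar> \<or> \<bar>x\<bar> \<le> \<bar>b\<bar>" by linarith
    then have "\<Phi> x \<le> \<Phi> a \<or> \<Phi> x \<le> \<Phi> b" using mono_abs by blast
    with a b show "x \<in> {x. \<Phi> x \<le> y}" by auto
  qed
  then show "{x \<in> space borel. \<Phi> x \<le> y} \<in> sets borel"
    using real_interval_borel_measurable by simp
qed

text \<open>
The weights may have a sum smaller than 1, since the missing mass can be put at 0, where
\<Phi> vanishes.
\<close>

lemma jensen:
  fixes w x :: "nat \<Rightarrow> real"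
  assumes "\<And>j. 0 \<le> w j" "(\<Sum>j<m. w j) \<le> 1"
  shows "\<Phi> (\<Sum>j<m. w j * x j) \<le> (\<Sum>j<m. ennreal (w j) * \<Phi> (x j))"
  using assms
proof (induction m arbitrary: w)
  case 0
  then show ?case by simp
next
  case (Suc m)
  have s: "0 \<le> (\<Sum>j<m. w j)" using Suc.prems by (intro sum_nonneg) auto
  have wm: "0 \<le> w m" "w m \<le> 1" using Suc.prems s by auto
  show ?case
  proof (cases "w m = 1")
    case True
    with Suc.prems(2) s have "(\<Sum>j<m. w j) = 0" by simp
    then have "\<forall>j<m. w j = 0" using Suc.prems(1) by (subst (asm) sum_nonneg_eq_0_iff) auto
    then show ?thesis using True by simp
  next
    case False
    define t where "t = 1 - w m"
    have t: "0 < t" using wm False by (simp add: t_def)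
    define v where "v j = w j / t" for j
    have "(\<Sum>j<m. v j) = (\<Sum>j<m. w j) / t" by (simp add: v_def sum_divide_distrib)
    also have "\<dots> \<le> 1" using Suc.prems t by (simp add: t_def)
    finally have v1: "(\<Sum>j<m. v j) \<le> 1" .
    have v0: "0 \<le> v j" for j using Suc.prems t by (simp add: v_def)
    have tv: "t * v j = w j" for j using t by (simp add: v_def)
    have eq: "(\<Sum>j<Suc m. w j * x j) = w m * x m + (1 - w m) * (\<Sum>j<m. v j * x j)"
      by (simp add: sum_distrib_left mult.assoc[symmetric] tv flip: t_def)
    have "\<Phi> (\<Sum>j<Suc m. w j * x j) \<le> ennreal (w m) * \<Phi> (x m) + ennreal t * \<Phi> (\<Sum>j<m. v j * x j)"
      unfolding eq t_def by (rule convex[OF wm])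
    also have "\<dots> \<le> ennreal (w m) * \<Phi> (x m) + ennreal t * (\<Sum>j<m. ennreal (v j) * \<Phi> (x j))"
      by (intro add_left_mono mult_left_mono Suc.IH v0 v1) auto
    also have "ennreal t * (\<Sum>j<m. ennreal (v j) * \<Phi> (x j)) = (\<Sum>j<m. ennreal (w j) * \<Phi> (x j))"
      using t v0 by (simp add: sum_distrib_left mult.assoc[symmetric] tv flip: ennreal_mult)
    finally show ?thesis by (simp add: add.commute)
  qed
qed

lemma half_sum_le: "\<Phi> ((x + y) / 2) \<le> ennreal (1/2) * \<Phi> x + ennreal (1/2) * \<Phi> y"
  using convex[of "1/2" x y] by (simp add: field_simps)

abbreviation modular :: "'a measure \<Rightarrow> ('a \<Rightarrow> real) \<Rightarrow> ennreal" where
  "modular M f \<equiv> \<integral>\<^sup>+x. \<Phi> (f x) \<partial>M"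

lemma gauge_le:
  assumes "0 < k" "modular M (\<lambda>x. f x / k) \<le> 1" shows "gauge_norm M \<Phi> f \<le> ennreal k"
  unfolding gauge_norm_def using assms by (intro Inf_lower) auto

lemma modular_le_1:
  assumes "gauge_norm M \<Phi> f < ennreal k" shows "modular M (\<lambda>x. f x / k) \<le> 1"
proof -
  from assms obtain l where l: "0 < l" "modular M (\<lambda>x. f x / l) \<le> 1" "ennreal l < ennreal k"
    unfolding gauge_norm_def by (auto simp: Inf_less_iff)
  then have "l < k" using ennreal_less_iff by (metis less_imp_le)
  have "modular M (\<lambda>x. f x / k) \<le> modular M (\<lambda>x. f x / l)"
    using l \<open>l < k\<close> by (intro nn_integral_mono mono_abs) (auto simp: abs_divide intro!: divide_left_mono)
  with l show ?thesis by (auto intro: order_trans)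
qed

lemma gauge_mono:
  assumes "\<And>x. x \<in> space M \<Longrightarrow> \<bar>f x\<bar> \<le> \<bar>g x\<bar>"
  shows "gauge_norm M \<Phi> f \<le> gauge_norm M \<Phi> g"
  unfolding gauge_norm_def
proof (rule Inf_superset_mono, clarify)
  fix k assume k: "0 < k" "modular M (\<lambda>x. g x / k) \<le> 1"
  have "modular M (\<lambda>x. f x / k) \<le> modular M (\<lambda>x. g x / k)"
    using assms k by (intro nn_integral_mono mono_abs) (auto simp: abs_divide intro!: divide_right_mono)
  with k show "\<exists>ka. ennreal k = ennreal ka \<and> 0 < ka \<and> modular M (\<lambda>x. f x / ka) \<le> 1"
    by (auto intro: order_trans)
qed

lemma gauge_cong_AE:
  assumes "AE x in M. f x = g x"
  shows "gauge_norm M \<Phi> f = gauge_norm M \<Phi> g"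
proof -
  have "modular M (\<lambda>x. f x / k) = modular M (\<lambda>x. g x / k)" for k
    using assms by (intro nn_integral_cong_AE) auto
  then show ?thesis by (simp add: gauge_norm_def)
qed

lemma gauge_AE_0:
  assumes "AE x in M. f x = 0"
  shows "gauge_norm M \<Phi> f = 0"
proof -
  have "gauge_norm M \<Phi> f = gauge_norm M \<Phi> (\<lambda>x. 0)" using assms by (rule gauge_cong_AE)
  also have "\<dots> \<le> ennreal e" if "0 < e" for e using that by (intro gauge_le) auto
  then have "gauge_norm M \<Phi> (\<lambda>x. 0) = 0"
    by (metis ennreal_le_epsilon add_0 le_zero_eq ennreal_0 )
  finally show ?thesis .
qed

lemma orlicz_fun_iff_gauge:
  "f \<in> orlicz_fun M \<Phi> \<longleftrightarrow> f \<in> borel_measurable M \<and> gauge_norm M \<Phi> f < \<infinity>"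
proof
  assume f: "f \<in> orlicz_fun M \<Phi>"
  then have [measurable]: "f \<in> borel_measurable M" by (simp add: orlicz_fun_def)
  from f obtain k where k: "0 < k" "modular M (\<lambda>x. k * f x) < \<infinity>" by (auto simp: orlicz_fun_def)
  then obtain r where r: "0 \<le> r" "modular M (\<lambda>x. k * f x) = ennreal r"
    by (cases "modular M (\<lambda>x. k * f x)") auto
  define t where "t = max 1 r"
  have t: "1 \<le> t" "r \<le> t" by (auto simp: t_def)
  have "modular M (\<lambda>x. f x / (t / k)) \<le> (\<integral>\<^sup>+x. ennreal (1/t) * \<Phi> (k * f x) \<partial>M)"
    using scale_le[of "1/t" "k * f x" for x] t by (intro nn_integral_mono) (auto simp: mult.commute)
  also have "\<dots> = ennreal (1/t) * ennreal r" by (subst nn_integral_cmult) (auto simp: r)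
  also have "\<dots> \<le> 1" using t r by (simp flip: ennreal_mult add: field_simps)
  finally have "gauge_norm M \<Phi> f \<le> ennreal (t / k)" using t k by (intro gauge_le) auto
  then show "f \<in> borel_measurable M \<and> gauge_norm M \<Phi> f < \<infinity>" by (auto simp: le_less_trans)
next
  assume f: "f \<in> borel_measurable M \<and> gauge_norm M \<Phi> f < \<infinity>"
  then obtain r where "0 \<le> r" "gauge_norm M \<Phi> f = ennreal r" by (cases "gauge_norm M \<Phi> f") auto
  then have "modular M (\<lambda>x. f x / (r + 1)) \<le> 1" by (intro modular_le_1) (auto simp: ennreal_less_iff)
  then have "modular M (\<lambda>x. (1 / (r + 1)) * f x) < \<infinity>" by (auto simp: le_less_trans)
  with f \<open>0 \<le> r\<close> show "f \<in> orlicz_fun M \<Phi>"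
    unfolding orlicz_fun_def by (auto intro!: exI[of _ "1 / (r + 1)"])
qed

lemma orlicz_fun_zero: "(\<lambda>x. 0) \<in> orlicz_fun M \<Phi>"
  by (auto simp: orlicz_fun_def intro!: exI[of _ 1])

lemma orlicz_fun_scale:
  assumes "f \<in> orlicz_fun M \<Phi>" shows "(\<lambda>x. c * f x) \<in> orlicz_fun M \<Phi>"
proof (cases "c = 0")
  case False
  from assms obtain k where "0 < k" "f \<in> borel_measurable M" "modular M (\<lambda>x. k * f x) < \<infinity>"
    by (auto simp: orlicz_fun_def)
  moreover have "modular M (\<lambda>x. k / \<bar>c\<bar> * (c * f x)) = modular M (\<lambda>x. k * f x)"
  proof (intro nn_integral_cong antisym mono_abs)
  qed (use False in \<open>auto simp: abs_mult\<close>)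
  ultimately show ?thesis using False by (auto simp: orlicz_fun_def intro!: exI[of _ "k / \<bar>c\<bar>"])
qed (simp add: orlicz_fun_zero)

lemma orlicz_fun_add:
  assumes "f \<in> orlicz_fun M \<Phi>" "g \<in> orlicz_fun M \<Phi>"
  shows "(\<lambda>x. f x + g x) \<in> orlicz_fun M \<Phi>"
proof -
  from assms have [measurable]: "f \<in> borel_measurable M" "g \<in> borel_measurable M"
    by (auto simp: orlicz_fun_def)
  from assms obtain k l where k: "0 < k" "modular M (\<lambda>x. k * f x) < \<infinity>"
    and l: "0 < l" "modular M (\<lambda>x. l * g x) < \<infinity>"
    by (auto simp: orlicz_fun_def)
  define m where "m = min k l"
  have m: "0 < m" "m \<le> k" "m \<le> l" using k l by (auto simp: m_def)
  have half: "ennreal (1/2) \<le> 1" using ennreal_leI[of "1/2" 1] by simp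
  have "modular M (\<lambda>x. m / 2 * (f x + g x)) \<le> (\<integral>\<^sup>+x. \<Phi> (k * f x) + \<Phi> (l * g x) \<partial>M)"
  proof (rule nn_integral_mono)
    fix x
    have "\<Phi> (m / 2 * (f x + g x)) \<le> ennreal (1/2) * \<Phi> (m * f x) + ennreal (1/2) * \<Phi> (m * g x)"
      using half_sum_le[of "m * f x" "m * g x"] by (simp add: field_simps)
    also have "\<dots> \<le> 1 * \<Phi> (k * f x) + 1 * \<Phi> (l * g x)"
      using m by (intro add_mono mult_mono mono_abs half) (auto simp: abs_mult intro: mult_right_mono)
    finally show "\<Phi> (m / 2 * (f x + g x)) \<le> \<Phi> (k * f x) + \<Phi> (l * g x)" by simp
  qed
  also have "\<dots> = modular M (\<lambda>x. k * f x) + modular M (\<lambda>x. l * g x)" by (rule nn_integral_add) auto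
  also have "\<dots> < \<infinity>" using k l by (auto simp: ennreal_add_less_top)
  finally show ?thesis using m by (auto simp: orlicz_fun_def intro!: exI[of _ "m / 2"])
qed

text \<open>
This replaces completeness of the Orlicz space. The partial sums of \<Sum>_j|u_j|, divided by
S=\<Sum>_j c_j, have modular at most 1 by convexity, so by monotone convergence they stay bounded
almost everywhere. The factor 2 is there because \<Phi> may jump to \<infinity> at a finite point and
need not be lower semicontinuous there: half of the full sum is dominated by a partial sum, and no
limit has to be taken inside \<Phi>.
\<close>

lemma series_modular:
  fixes u :: "nat \<Rightarrow> 'a \<Rightarrow> real"
  assumes u [measurable]: "\<And>j. u j \<in> borel_measurable M"
    and c: "\<And>j. 0 < c j" "summable c"
    and le: "\<And>j. modular M (\<lambda>x. u j x / c j) \<le> 1"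
  shows "AE x in M. summable (\<lambda>j. u j x)"
    and "modular M (\<lambda>x. (\<Sum>j. u j x) / (2 * suminf c)) \<le> 1"
proof -
  define S where "S = suminf c"
  have S: "0 < S" unfolding S_def using c by (intro suminf_pos) auto
  have part: "(\<Sum>j<m. c j) \<le> S" for m unfolding S_def using c by (intro sum_le_suminf) (auto intro: less_imp_le)
  define P where "P m x = \<Phi> ((\<Sum>j<m. \<bar>u j x\<bar>) / S)" for m x
  have [measurable]: "P m \<in> borel_measurable M" for m unfolding P_def by measurable
  have inc: "incseq (\<lambda>m. P m x)" for x
    unfolding P_def using S by (intro incseq_SucI mono_nonneg) (auto intro!: divide_right_mono sum_nonneg divide_nonneg_pos)
  have "(\<integral>\<^sup>+x. P m x \<partial>M) \<le> 1" for m
  proof -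
    have "(\<integral>\<^sup>+x. P m x \<partial>M) \<le> (\<integral>\<^sup>+x. (\<Sum>j<m. ennreal (c j / S) * \<Phi> (u j x / c j)) \<partial>M)"
    proof (rule nn_integral_mono)
      fix x
      have "P m x = \<Phi> (\<Sum>j<m. (c j / S) * (\<bar>u j x\<bar> / c j))"
        unfolding P_def using c(1) by (simp add: sum_divide_distrib less_imp_neq[symmetric])
      also have "\<dots> \<le> (\<Sum>j<m. ennreal (c j / S) * \<Phi> (\<bar>u j x\<bar> / c j))"
        using c S part[of m] by (intro jensen) (auto simp: less_imp_le simp flip: sum_divide_distrib)
      also have "\<dots> = (\<Sum>j<m. ennreal (c j / S) * \<Phi> (u j x / c j))"
      proof -
        have "\<Phi> (\<bar>u j x\<bar> / c j) = \<Phi> (u j x / c j)" for j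
          using apply_abs[of "u j x / c j"] c(1)[of j] by (simp add: abs_divide)
        then show ?thesis by simp
      qed
      finally show "P m x \<le> (\<Sum>j<m. ennreal (c j / S) * \<Phi> (u j x / c j))" .
    qed
    also have "\<dots> = (\<Sum>j<m. ennreal (c j / S) * modular M (\<lambda>x. u j x / c j))"
      by (subst nn_integral_sum) (auto simp: nn_integral_cmult)
    also have "\<dots> \<le> (\<Sum>j<m. ennreal (c j / S) * 1)"
      by (intro sum_mono mult_left_mono le) auto
    also have "\<dots> = ennreal ((\<Sum>j<m. c j) / S)"
      using c S by (simp add: less_imp_le sum_divide_distrib)
    also have "\<dots> \<le> 1" using part S by simp
    finally show ?thesis .
  qed
  then have "(SUP m. \<integral>\<^sup>+x. P m x \<partial>M) \<le> 1" by (intro SUP_least)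
  also have "(SUP m. \<integral>\<^sup>+x. P m x \<partial>M) = (\<integral>\<^sup>+x. (SUP m. P m x) \<partial>M)"
    using inc by (intro nn_integral_monotone_convergence_SUP[symmetric]) (auto simp: incseq_def le_fun_def)
  finally have sup: "(\<integral>\<^sup>+x. (SUP m. P m x) \<partial>M) \<le> 1" .
  then have "(\<integral>\<^sup>+x. (SUP m. P m x) \<partial>M) \<noteq> \<infinity>" by (auto simp: top_unique)
  then have fin: "AE x in M. (SUP m. P m x) \<noteq> \<infinity>" by (intro nn_integral_PInf_AE) auto
  have summ: "summable (\<lambda>j. \<bar>u j x\<bar>)" if x: "(SUP m. P m x) \<noteq> \<infinity>" for x
  proof -
    obtain r where r: "(SUP m. P m x) = ennreal r" using x by (cases "SUP m. P m x") auto
    obtain b where b: "b > 0" "ennreal r < \<Phi> b" using exceeds[of 0 r] by blast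
    have "(\<Sum>j<m. \<bar>u j x\<bar>) \<le> b * S" for m
    proof (rule ccontr)
      assume "\<not> (\<Sum>j<m. \<bar>u j x\<bar>) \<le> b * S"
      then have "\<Phi> b \<le> P m x" unfolding P_def using b S by (intro mono_nonneg) (auto simp: field_simps)
      also have "\<dots> \<le> ennreal r" unfolding r[symmetric] by (intro SUP_upper) auto
      finally show False using b by simp
    qed
    then show ?thesis by (intro summableI_nonneg_bounded) auto
  qed
  show "AE x in M. summable (\<lambda>j. u j x)"
    using fin by (rule AE_mp) (rule AE_I2, rule impI, rule summable_rabs_cancel, rule summ)
  have "AE x in M. \<Phi> ((\<Sum>j. u j x) / (2 * S)) \<le> (SUP m. P m x)"
  proof (rule AE_mp[OF fin], intro AE_I2 impI)
    fix x assume x: "(SUP m. P m x) \<noteq> \<infinity>"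
    define B where "B = (\<Sum>j. \<bar>u j x\<bar>)"
    have sx: "summable (\<lambda>j. \<bar>u j x\<bar>)" by (rule summ[OF x])
    have le: "\<bar>\<Sum>j. u j x\<bar> \<le> B" unfolding B_def by (rule summable_rabs[OF sx])
    show "\<Phi> ((\<Sum>j. u j x) / (2 * S)) \<le> (SUP m. P m x)"
    proof (cases "B = 0")
      case True
      with le show ?thesis by simp
    next
      case False
      with le have B: "B / 2 < B" by linarith
      have "(\<lambda>m. \<Sum>j<m. \<bar>u j x\<bar>) \<longlonglongrightarrow> B" unfolding B_def using sx by (rule summable_LIMSEQ)
      from order_tendstoD(1)[OF this B] obtain m where m: "B / 2 < (\<Sum>j<m. \<bar>u j x\<bar>)"
        by (auto simp: eventually_sequentially)
      have "\<Phi> ((\<Sum>j. u j x) / (2 * S)) \<le> P m x"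
        unfolding P_def using le m S by (intro mono_abs) (auto simp: abs_divide field_simps sum_nonneg)
      also have "\<dots> \<le> (SUP m. P m x)" by (intro SUP_upper) auto
      finally show ?thesis .
    qed
  qed
  then have "modular M (\<lambda>x. (\<Sum>j. u j x) / (2 * S)) \<le> (\<integral>\<^sup>+x. (SUP m. P m x) \<partial>M)"
    by (rule nn_integral_mono_AE)
  with sup show "modular M (\<lambda>x. (\<Sum>j. u j x) / (2 * suminf c)) \<le> 1"
    by (auto simp: S_def intro: order_trans)
qed

end

section \<open>The generalized inverse of a Young's function\<close>

locale proper_young_fn = young_fn +
  assumes proper: "\<exists>b>0. \<Phi> b < \<infinity>"
begin

abbreviation "inv_\<Phi> \<equiv> young_inverse \<Phi>"

lemma inv_set: "{x. 0 \<le> x \<and> \<Phi> x > ennreal y} \<noteq> {}" "bdd_below {x. 0 \<le> x \<and> \<Phi> x > ennreal y}"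
proof -
  obtain x where "x > 0" "ennreal y < \<Phi> x" using exceeds[of 0 y] by blast
  then show "{x. 0 \<le> x \<and> \<Phi> x > ennreal y} \<noteq> {}" by (auto intro!: exI[of _ x])
  show "bdd_below {x. 0 \<le> x \<and> \<Phi> x > ennreal y}" by (rule bdd_belowI[of _ 0]) auto
qed

lemma above_inverse:
  assumes "inv_\<Phi> y < x" shows "ennreal y < \<Phi> x"
proof -
  obtain s where s: "0 \<le> s" "ennreal y < \<Phi> s" "s < x"
    using assms inv_set[of y] by (auto simp: young_inverse_def cInf_less_iff)
  then show ?thesis using mono_nonneg[of s x] by auto
qed

lemma below_inverse:
  assumes "0 \<le> x" "x < inv_\<Phi> y" shows "\<Phi> x \<le> ennreal y"
proof (rule ccontr)
  assume "\<not> \<Phi> x \<le> ennreal y"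
  then have "inv_\<Phi> y \<le> x" unfolding young_inverse_def
    using assms inv_set[of y] by (intro cInf_lower) auto
  with assms show False by simp
qed

lemma le_inverse:
  assumes "\<And>x. ennreal y < \<Phi> x \<Longrightarrow> 0 \<le> x \<Longrightarrow> b \<le> x" shows "b \<le> inv_\<Phi> y"
  unfolding young_inverse_def using assms inv_set[of y] by (intro cInf_greatest) auto

lemma inverse_mono: assumes "s \<le> t" shows "inv_\<Phi> s \<le> inv_\<Phi> t"
proof (rule le_inverse, rule ccontr)
  fix x assume x: "ennreal t < \<Phi> x" "0 \<le> x" "\<not> inv_\<Phi> s \<le> x"
  then have "\<Phi> x \<le> ennreal s" by (intro below_inverse) auto
  also have "\<dots> \<le> ennreal t" using assms by (rule ennreal_leI)
  finally show False using x by simp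
qed

lemma inverse_pos: assumes "0 < y" shows "0 < inv_\<Phi> y"
proof -
  obtain b where b: "0 < b" "\<Phi> b < \<infinity>" using proper by blast
  then obtain r where r: "0 \<le> r" "\<Phi> b = ennreal r" by (cases "\<Phi> b") auto
  define t where "t = min 1 (y / (r + 1))"
  have t: "0 < t" "t \<le> 1" "t \<le> y / (r + 1)" using assms r by (auto simp: t_def)
  then have "t * (r + 1) \<le> y" using r by (simp add: pos_le_divide_eq)
  then have tr: "t * r \<le> y" using t by (simp add: algebra_simps)
  have "\<Phi> (t * b) \<le> ennreal t * \<Phi> b" using t by (intro scale_le) auto
  also have "\<dots> = ennreal (t * r)" using t r by (simp add: ennreal_mult)
  also have "\<dots> \<le> ennreal y" by (intro ennreal_leI tr)
  finally have le: "\<Phi> (t * b) \<le> ennreal y" .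
  have "t * b \<le> inv_\<Phi> y"
  proof (rule le_inverse, rule ccontr)
    fix x assume "ennreal y < \<Phi> x" "0 \<le> x" "\<not> t * b \<le> x"
    with mono_nonneg[of x "t * b"] le show False by auto
  qed
  moreover have "0 < t * b" using t b by simp
  ultimately show ?thesis by linarith
qed

lemma inverse_concave: assumes "0 < s" "s \<le> t" shows "(s / t) * inv_\<Phi> t \<le> inv_\<Phi> s"
proof (rule le_inverse, rule ccontr)
  fix x assume x: "ennreal s < \<Phi> x" "0 \<le> x" "\<not> s / t * inv_\<Phi> t \<le> x"
  then have "x * (t / s) < inv_\<Phi> t" using assms by (simp add: field_simps)
  then have le: "\<Phi> (x * (t / s)) \<le> ennreal t" using x assms by (intro below_inverse) auto
  have "\<Phi> x = \<Phi> ((s / t) * (x * (t / s)))" using assms by simp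
  also have "\<dots> \<le> ennreal (s / t) * \<Phi> (x * (t / s))" using assms by (intro scale_le) auto
  also have "\<dots> \<le> ennreal (s / t) * ennreal t" by (intro mult_left_mono le) auto
  also have "\<dots> = ennreal s" using assms by (simp flip: ennreal_mult)
  finally show False using x by simp
qed

text \<open>
Concavity of the inverse carries a strict comparison of its values over to the arguments, with the
same factor. For a factor \<ge> 1 this would fail, for instance where the inverse is flat.
\<close>

lemma inverse_less_imp_ratio:
  assumes "0 < s" "0 < t" "r < 1" "inv_\<Phi> s \<le> r * inv_\<Phi> t"
  shows "s \<le> r * t"
proof -
  have pos: "0 < inv_\<Phi> t" using assms by (intro inverse_pos)
  show ?thesis
  proof (cases "s \<le> t")
    case True
    have "(s / t) * inv_\<Phi> t \<le> r * inv_\<Phi> t" using inverse_concave[OF assms(1) True] assms by linarith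
    then have "s / t \<le> r" by (simp only: mult_le_cancel_right_pos[OF pos])
    then show ?thesis using assms by (simp add: field_simps)
  next
    case False
    then have "inv_\<Phi> t \<le> r * inv_\<Phi> t" using inverse_mono[of t s] assms by linarith
    with pos assms show ?thesis by (simp add: mult_le_cancel_right1)
  qed
qed

text \<open>
The reciprocal of the gauge of the indicator of \<open>F\<close> (see \<open>gauge_scaled_indicator\<close>). In this form
the quantities a_k are levels of the sets \<phi>^k(W).
\<close>

definition level :: "'a measure \<Rightarrow> 'a set \<Rightarrow> real" where
  "level M F = inv_\<Phi> (1 / measure M F)"

lemma gauge_scaled_indicator:
  assumes F: "F \<in> sets M" "0 < emeasure M F" "emeasure M F < \<infinity>" and s: "0 < s"
  shows "gauge_norm M \<Phi> (\<lambda>x. s * indicator F x) = ennreal (s / level M F)"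
proof -
  define m where "m = measure M F"
  have em: "emeasure M F = ennreal m" using F(3) by (simp add: m_def emeasure_eq_ennreal_measure)
  have m: "0 < m" using F(2) by (simp add: em)
  define v where "v = level M F"
  have v: "0 < v" unfolding v_def level_def using m by (intro inverse_pos) (simp add: m_def)
  have vdef: "v = inv_\<Phi> (1 / m)" by (simp add: v_def level_def m_def)
  have mod: "modular M (\<lambda>x. s * indicator F x / k) = \<Phi> (s / k) * ennreal m" for k
  proof -
    have "modular M (\<lambda>x. s * indicator F x / k) = (\<integral>\<^sup>+x. \<Phi> (s / k) * indicator F x \<partial>M)"
      by (intro nn_integral_cong) (auto simp: indicator_def)
    also have "\<dots> = \<Phi> (s / k) * ennreal m" using F(1) by (simp add: nn_integral_cmult_indicator em)
    finally show ?thesis .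
  qed
  show ?thesis
    unfolding gauge_norm_def mod v_def[symmetric]
  proof (rule antisym)
    show "Inf {ennreal k |k. 0 < k \<and> \<Phi> (s / k) * ennreal m \<le> 1} \<le> ennreal (s / v)"
    proof (rule ennreal_le_epsilon)
      fix e :: real assume e: "0 < e"
      define k where "k = s / v + e"
      have k: "0 < k" "s / k < v" using s v e by (auto simp: k_def field_simps add_pos_pos)
      then have "\<Phi> (s / k) \<le> ennreal (1 / m)" using s unfolding vdef by (intro below_inverse) auto
      then have "\<Phi> (s / k) * ennreal m \<le> ennreal (1 / m) * ennreal m" by (rule mult_right_mono) auto
      also have "\<dots> = 1" using m by (simp flip: ennreal_mult)
      finally have "Inf {ennreal k |k. 0 < k \<and> \<Phi> (s / k) * ennreal m \<le> 1} \<le> ennreal k"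
        using k by (intro Inf_lower) auto
      then show "Inf {ennreal k |k. 0 < k \<and> \<Phi> (s / k) * ennreal m \<le> 1} \<le> ennreal (s / v) + ennreal e"
        using s v e by (simp add: k_def ennreal_plus less_imp_le)
    qed
    show "ennreal (s / v) \<le> Inf {ennreal k |k. 0 < k \<and> \<Phi> (s / k) * ennreal m \<le> 1}"
    proof (rule Inf_greatest, clarify)
      fix k assume k: "0 < k" "\<Phi> (s / k) * ennreal m \<le> 1"
      show "ennreal (s / v) \<le> ennreal k"
      proof (rule ccontr)
        assume "\<not> ennreal (s / v) \<le> ennreal k"
        then have "k < s / v" using k by (metis ennreal_leI not_less)
        then have "v < s / k" using k v by (simp add: field_simps)
        then have "ennreal (1 / m) < \<Phi> (s / k)" unfolding vdef by (rule above_inverse)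
        also have "\<Phi> (s / k) = \<Phi> (s / k) * ennreal m * ennreal (1 / m)"
          using m by (simp add: mult.assoc flip: ennreal_mult)
        also have "\<dots> \<le> 1 * ennreal (1 / m)" by (intro mult_right_mono k) auto
        finally show False by simp
      qed
    qed
  qed
qed

end

section \<open>Composition operators on classes of functions\<close>

text \<open>
A set inequality for preimages of subsets of \<open>A\<close> is an inequality of measures for the restricted image
measure, and integrals are monotone in the measure.
\<close>

lemma nn_integral_compose_le:
  assumes T [measurable]: "T \<in> measurable M M" and A [measurable]: "A \<in> sets M"
    and le: "\<And>F. F \<in> sets M \<Longrightarrow> F \<subseteq> A \<Longrightarrow> emeasure M (T -` F \<inter> space M) \<le> r * emeasure M F"
    and f: "f \<in> borel_measurable M"
  shows "(\<integral>\<^sup>+x. f (T x) * indicator A (T x) \<partial>M) \<le> r * (\<integral>\<^sup>+x. f x \<partial>M)"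
proof -
  note [measurable] = f
  let ?N = "density (distr M M T) (indicator A)"
  have "(\<integral>\<^sup>+x. f (T x) * indicator A (T x) \<partial>M) = (\<integral>\<^sup>+x. f x \<partial>?N)"
    by (simp add: nn_integral_density nn_integral_distr mult.commute)
  also have "\<dots> \<le> (\<integral>\<^sup>+x. f x \<partial>scale_measure r M)"
  proof (rule nn_integral_mono_measure)
    have "emeasure ?N F \<le> r * emeasure M F" if [measurable]: "F \<in> sets M" for F
    proof -
      have "emeasure ?N F = emeasure M (T -` (A \<inter> F) \<inter> space M)"
        by (simp add: emeasure_density emeasure_distr flip: indicator_inter_arith)
      also have "\<dots> \<le> r * emeasure M (A \<inter> F)" by (rule le) auto
      also have "\<dots> \<le> r * emeasure M F" by (intro mult_left_mono emeasure_mono) auto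
      finally show ?thesis .
    qed
    then have "emeasure ?N F \<le> emeasure (scale_measure r M) F" for F
      by (cases "F \<in> sets M") (auto simp: emeasure_notin_sets)
    then show "?N \<le> scale_measure r M"
      by (auto simp: le_measure_iff le_fun_def space_scale_measure)
  qed simp
  also have "\<dots> = r * (\<integral>\<^sup>+x. f x \<partial>M)" by (simp add: nn_integral_scale_measure)
  finally show ?thesis .
qed

context young_fn
begin

lemma equiv_orlicz_rel: "equiv (orlicz_fun M \<Phi>) (orlicz_rel M \<Phi>)"
proof (rule equivI)
  show "orlicz_rel M \<Phi> \<subseteq> orlicz_fun M \<Phi> \<times> orlicz_fun M \<Phi>" by (auto simp: orlicz_rel_def)
  show "refl_on (orlicz_fun M \<Phi>) (orlicz_rel M \<Phi>)" by (auto simp: refl_on_def orlicz_rel_def)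
  show "sym (orlicz_rel M \<Phi>)" by (auto simp: sym_def orlicz_rel_def elim: AE_mp)
  show "trans (orlicz_rel M \<Phi>)"
  proof (rule transI)
    fix f g h assume "(f, g) \<in> orlicz_rel M \<Phi>" "(g, h) \<in> orlicz_rel M \<Phi>"
    then have "f \<in> orlicz_fun M \<Phi>" "h \<in> orlicz_fun M \<Phi>" "AE x in M. f x = g x" "AE x in M. g x = h x"
      by (auto simp: orlicz_rel_def)
    moreover from this(3,4) have "AE x in M. f x = h x" by eventually_elim simp
    ultimately show "(f, h) \<in> orlicz_rel M \<Phi>" by (auto simp: orlicz_rel_def)
  qed
qed

lemma class_eq_iff:
  assumes "f \<in> orlicz_fun M \<Phi>" "g \<in> orlicz_fun M \<Phi>"
  shows "orlicz_class M \<Phi> f = orlicz_class M \<Phi> g \<longleftrightarrow> (AE x in M. f x = g x)"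
  using assms by (subst eq_equiv_class_iff[OF equiv_orlicz_rel]) (auto simp: orlicz_rel_def)

lemma class_self: "f \<in> orlicz_fun M \<Phi> \<Longrightarrow> f \<in> orlicz_class M \<Phi> f"
  by (simp add: orlicz_rel_def)

lemma points_orlicz: "points (orlicz_space M \<Phi>) = orlicz_class M \<Phi> ` orlicz_fun M \<Phi>"
  by (auto simp: orlicz_space_def quotient_def)

lemma UN_class_const:
  assumes "f \<in> orlicz_fun M \<Phi>" "\<And>g. g \<in> orlicz_fun M \<Phi> \<Longrightarrow> AE x in M. f x = g x \<Longrightarrow> H g = X"
  shows "(\<Union>g\<in>orlicz_class M \<Phi> f. H g) = X"
proof (rule SUP_eq_const)
  show "orlicz_class M \<Phi> f \<noteq> {}" using class_self[OF assms(1)] by blast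
  fix g assume "g \<in> orlicz_class M \<Phi> f"
  then have "g \<in> orlicz_fun M \<Phi>" "AE x in M. f x = g x" by (simp_all add: orlicz_rel_def)
  then show "H g = X" by (rule assms(2))
qed

lemma norm_orlicz:
  assumes "f \<in> orlicz_fun M \<Phi>"
  shows "norm_sp (orlicz_space M \<Phi>) (orlicz_class M \<Phi> f) = enn2real (gauge_norm M \<Phi> f)"
proof -
  have "enn2real (gauge_norm M \<Phi> g) = enn2real (gauge_norm M \<Phi> f)" if "g \<in> orlicz_class M \<Phi> f" for g
    using that gauge_cong_AE[of f g M] by (simp add: orlicz_rel_def)
  moreover have "orlicz_class M \<Phi> f \<noteq> {}" using class_self[OF assms] by blast
  ultimately show ?thesis
    unfolding orlicz_space_def normed_sp.simps by (intro the_elem_image_unique)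
qed

lemma scale_orlicz:
  assumes "f \<in> orlicz_fun M \<Phi>"
  shows "scale_sp (orlicz_space M \<Phi>) c (orlicz_class M \<Phi> f) = orlicz_class M \<Phi> (\<lambda>x. c * f x)"
  unfolding orlicz_space_def normed_sp.simps
proof (intro UN_class_const assms)
  fix g assume g: "g \<in> orlicz_fun M \<Phi>" "AE x in M. f x = g x"
  from g(2) have "AE x in M. c * g x = c * f x" by eventually_elim simp
  then show "orlicz_class M \<Phi> (\<lambda>x. c * g x) = orlicz_class M \<Phi> (\<lambda>x. c * f x)"
    using g assms by (subst class_eq_iff) (auto simp: orlicz_fun_scale)
qed

lemma plus_orlicz:
  assumes "f \<in> orlicz_fun M \<Phi>" "g \<in> orlicz_fun M \<Phi>"
  shows "plus_sp (orlicz_space M \<Phi>) (orlicz_class M \<Phi> f) (orlicz_class M \<Phi> g) = orlicz_class M \<Phi> (\<lambda>x. f x + g x)"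
  unfolding orlicz_space_def normed_sp.simps
proof (intro UN_class_const assms)
  fix f' g' assume f': "f' \<in> orlicz_fun M \<Phi>" "AE x in M. f x = f' x"
    and g': "g' \<in> orlicz_fun M \<Phi>" "AE x in M. g x = g' x"
  have "AE x in M. f' x + g' x = f x + g x" using f'(2) g'(2) by eventually_elim simp
  then show "orlicz_class M \<Phi> (\<lambda>x. f' x + g' x) = orlicz_class M \<Phi> (\<lambda>x. f x + g x)"
    using f' g' assms by (subst class_eq_iff) (auto simp: orlicz_fun_add)
qed

lemma orlicz_fun_diff:
  assumes "f \<in> orlicz_fun M \<Phi>" "g \<in> orlicz_fun M \<Phi>"
  shows "(\<lambda>x. f x - g x) \<in> orlicz_fun M \<Phi>"
  using orlicz_fun_add[OF assms(1) orlicz_fun_scale[OF assms(2), of "- 1"]] by simp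

lemma norm_diff_orlicz:
  assumes "f \<in> orlicz_fun M \<Phi>" "g \<in> orlicz_fun M \<Phi>"
  shows "norm_sp (orlicz_space M \<Phi>) (diff_sp (orlicz_space M \<Phi>) (orlicz_class M \<Phi> f) (orlicz_class M \<Phi> g)) =
    enn2real (gauge_norm M \<Phi> (\<lambda>x. f x - g x))"
proof -
  have "diff_sp (orlicz_space M \<Phi>) (orlicz_class M \<Phi> f) (orlicz_class M \<Phi> g) = orlicz_class M \<Phi> (\<lambda>x. f x - g x)"
    using plus_orlicz[OF assms(1) orlicz_fun_scale[OF assms(2), of "- 1"]]
    by (simp add: diff_sp_def scale_orlicz[OF assms(2)])
  then show ?thesis using norm_orlicz[OF orlicz_fun_diff[OF assms]] by simp
qed

end

text \<open>
The iterates of a bijection, together with those of its inverse, are treated as an action \<open>E\<close> of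
the integers. Reversing time is then the substitution of \<open>-k\<close> for \<open>k\<close>, and every lemma about one
direction of time yields the other one.
\<close>

locale orlicz_action = young_fn \<Phi> for \<Phi> +
  fixes M :: "'a measure" and E :: "int \<Rightarrow> 'a \<Rightarrow> 'a" and c :: real
  assumes E_measurable [measurable]: "\<And>k. E k \<in> measurable M M"
    and E_add: "\<And>j k x. x \<in> space M \<Longrightarrow> E j (E k x) = E (j + k) x"
    and E_zero: "\<And>x. x \<in> space M \<Longrightarrow> E 0 x = x"
    and c_ge_1: "1 \<le> c"
    and domination: "\<And>\<sigma> F. \<sigma> \<in> {1, -1} \<Longrightarrow> F \<in> sets M \<Longrightarrow>
      emeasure M (E \<sigma> -` F \<inter> space M) \<le> ennreal c * emeasure M F"
begin

lemma E_space: "x \<in> space M \<Longrightarrow> E k x \<in> space M"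
  by (rule measurable_space[OF E_measurable])

lemma emeasure_iterate_le_aux:
  assumes \<sigma>: "\<sigma> \<in> {1, -1}" and F: "F \<in> sets M"
  shows "emeasure M (E (\<sigma> * int n) -` F \<inter> space M) \<le> ennreal (c ^ n) * emeasure M F"
proof (induction n)
  case 0
  have "E 0 -` F \<inter> space M = F" using sets.sets_into_space[OF F] by (auto simp: E_zero)
  then show ?case by simp
next
  case (Suc n)
  let ?G = "E (\<sigma> * int n) -` F \<inter> space M"
  have G: "?G \<in> sets M" using F by measurable
  have "E (\<sigma> * int (Suc n)) -` F \<inter> space M = E \<sigma> -` ?G \<inter> space M"
    by (auto simp: E_space E_add algebra_simps)
  also have "emeasure M \<dots> \<le> ennreal c * emeasure M ?G" by (rule domination[OF \<sigma> G])
  also have "\<dots> \<le> ennreal c * (ennreal (c ^ n) * emeasure M F)" using Suc by (intro mult_left_mono) auto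
  also have "\<dots> = ennreal (c ^ Suc n) * emeasure M F"
    using c_ge_1 by (simp add: ennreal_mult mult.assoc)
  finally show ?case .
qed

lemma emeasure_iterate_le:
  assumes "F \<in> sets M"
  shows "emeasure M (E k -` F \<inter> space M) \<le> ennreal (c ^ nat \<bar>k\<bar>) * emeasure M F"
  using emeasure_iterate_le_aux[OF _ assms, of 1 "nat k"] emeasure_iterate_le_aux[OF _ assms, of "-1" "nat (- k)"]
  by (cases "k \<ge> 0") auto

lemma AE_iterate:
  assumes "AE x in M. P x" shows "AE x in M. P (E k x)"
proof -
  from assms obtain N where N: "{x \<in> space M. \<not> P x} \<subseteq> N" "N \<in> sets M" "emeasure M N = 0"
    by (auto elim!: AE_E)
  show ?thesis
  proof (rule AE_I)
    show "{x \<in> space M. \<not> P (E k x)} \<subseteq> E k -` N \<inter> space M" using N E_space by auto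
    show "emeasure M (E k -` N \<inter> space M) = 0"
      using emeasure_iterate_le[OF N(2), of k] N by simp
    show "E k -` N \<inter> space M \<in> sets M" using N by measurable
  qed
qed

lemma modular_iterate_le:
  assumes "f \<in> borel_measurable M"
  shows "modular M (\<lambda>x. f (E k x)) \<le> ennreal (c ^ nat \<bar>k\<bar>) * modular M f"
proof -
  have "modular M (\<lambda>x. f (E k x)) = (\<integral>\<^sup>+x. \<Phi> (f (E k x)) * indicator (space M) (E k x) \<partial>M)"
    using E_space by (intro nn_integral_cong) auto
  also have "\<dots> \<le> ennreal (c ^ nat \<bar>k\<bar>) * modular M f"
    using assms by (intro nn_integral_compose_le[of "E k" M "space M" _ "\<lambda>x. \<Phi> (f x)"] emeasure_iterate_le) auto
  finally show ?thesis .
qed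

lemma orlicz_fun_iterate:
  assumes "f \<in> orlicz_fun M \<Phi>" shows "(\<lambda>x. f (E k x)) \<in> orlicz_fun M \<Phi>"
proof -
  from assms obtain l where l: "0 < l" "modular M (\<lambda>x. l * f x) < \<infinity>"
    and [measurable]: "f \<in> borel_measurable M" by (auto simp: orlicz_fun_def)
  have "modular M (\<lambda>x. l * f (E k x)) \<le> ennreal (c ^ nat \<bar>k\<bar>) * modular M (\<lambda>x. l * f x)"
    by (rule modular_iterate_le) measurable
  also have "\<dots> < \<infinity>" using l by (auto simp: ennreal_mult_less_top)
  finally show ?thesis using l by (auto simp: orlicz_fun_def)
qed

abbreviation "T \<equiv> composition_operator M \<Phi> (E 1)"
abbreviation "Y \<equiv> orlicz_space M \<Phi>"

lemma T_class:
  assumes "f \<in> orlicz_fun M \<Phi>"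
  shows "T (orlicz_class M \<Phi> f) = orlicz_class M \<Phi> (\<lambda>x. f (E 1 x))"
  unfolding composition_operator_def
proof (intro UN_class_const assms)
  fix g assume g: "g \<in> orlicz_fun M \<Phi>" "AE x in M. f x = g x"
  from AE_iterate[OF g(2), of 1] have "AE x in M. g (E 1 x) = f (E 1 x)" by eventually_elim simp
  then show "orlicz_class M \<Phi> (g \<circ> E 1) = orlicz_class M \<Phi> (\<lambda>x. f (E 1 x))"
    unfolding comp_def using g assms by (subst class_eq_iff) (auto simp: orlicz_fun_iterate)
qed

lemma class_back_forth:
  assumes "f \<in> orlicz_fun M \<Phi>"
  shows "T (orlicz_class M \<Phi> (\<lambda>x. f (E (-1) x))) = orlicz_class M \<Phi> f"
proof -
  have "AE x in M. f (E (-1) (E 1 x)) = f x" by (rule AE_I2) (simp add: E_add E_zero)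
  then show ?thesis using assms orlicz_fun_iterate[OF orlicz_fun_iterate[OF assms, of "-1"], of 1]
    by (simp add: T_class orlicz_fun_iterate class_eq_iff)
qed

lemma inj_T: "inj_on T (points Y)"
proof (rule inj_onI)
  fix A B assume "A \<in> points Y" "B \<in> points Y" and eq: "T A = T B"
  then obtain f g where f: "f \<in> orlicz_fun M \<Phi>" "A = orlicz_class M \<Phi> f"
    and g: "g \<in> orlicz_fun M \<Phi>" "B = orlicz_class M \<Phi> g" by (auto simp: points_orlicz)
  from eq have "AE x in M. f (E 1 x) = g (E 1 x)"
    using f g by (simp add: T_class class_eq_iff orlicz_fun_iterate)
  from AE_iterate[OF this, of "-1"] have "AE x in M. f (E 1 (E (-1) x)) = g (E 1 (E (-1) x))" .
  then have "AE x in M. f x = g x" by (rule AE_mp) (auto intro!: AE_I2 simp: E_add E_zero)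
  then show "A = B" using f g by (simp add: class_eq_iff)
qed

lemma inv_T_class:
  assumes "f \<in> orlicz_fun M \<Phi>"
  shows "inv_into (points Y) T (orlicz_class M \<Phi> f) = orlicz_class M \<Phi> (\<lambda>x. f (E (-1) x))"
  using assms by (intro inv_into_f_eq inj_T class_back_forth) (auto simp: points_orlicz orlicz_fun_iterate)

lemma iterate_T_class:
  assumes "f \<in> orlicz_fun M \<Phi>"
  shows "int_iterate (points Y) T n (orlicz_class M \<Phi> f) = orlicz_class M \<Phi> (\<lambda>x. f (E n x))"
proof -
  have fwd: "(T ^^ m) (orlicz_class M \<Phi> f) = orlicz_class M \<Phi> (\<lambda>x. f (E (int m) x))" for m
  proof (induction m)
    case 0 then show ?case
      using assms AE_I2[of M "\<lambda>x. f x = f (E 0 x)"] by (simp add: class_eq_iff orlicz_fun_iterate E_zero)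
  next
    case (Suc m)
    have "AE x in M. f (E (int m) (E 1 x)) = f (E (int (Suc m)) x)"
      by (rule AE_I2) (simp add: E_add algebra_simps)
    then show ?case using Suc assms orlicz_fun_iterate[OF orlicz_fun_iterate[OF assms, of "int m"], of 1]
      by (simp add: T_class orlicz_fun_iterate class_eq_iff)
  qed
  have bwd: "(inv_into (points Y) T ^^ m) (orlicz_class M \<Phi> f) = orlicz_class M \<Phi> (\<lambda>x. f (E (- int m) x))" for m
  proof (induction m)
    case 0 then show ?case
      using assms AE_I2[of M "\<lambda>x. f x = f (E 0 x)"] by (simp add: class_eq_iff orlicz_fun_iterate E_zero)
  next
    case (Suc m)
    have "AE x in M. f (E (- int m) (E (-1) x)) = f (E (- int (Suc m)) x)"
      by (rule AE_I2) (simp add: E_add algebra_simps)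
    then show ?case using Suc assms orlicz_fun_iterate[OF orlicz_fun_iterate[OF assms, of "- int m"], of "-1"]
      by (simp add: inv_T_class orlicz_fun_iterate class_eq_iff)
  qed
  show ?thesis using fwd[of "nat n"] bwd[of "nat (- n)"] by (auto simp: int_iterate_def)
qed

text \<open>
Classes can be replaced by representatives throughout. All gauges that occur are finite, so the
passage between real and extended norms loses nothing.
\<close>

lemma shadowing_iff_functions:
  "has_shadowing_property Y T \<longleftrightarrow>
    (\<forall>\<epsilon>>0. \<exists>\<delta>>0. \<forall>y :: int \<Rightarrow> 'a \<Rightarrow> real.
      (\<forall>n. y n \<in> orlicz_fun M \<Phi>) \<and> (\<forall>n. gauge_norm M \<Phi> (\<lambda>x. y n (E 1 x) - y (n + 1) x) \<le> ennreal \<delta>) \<longrightarrow>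
      (\<exists>z\<in>orlicz_fun M \<Phi>. \<forall>n. gauge_norm M \<Phi> (\<lambda>x. z (E n x) - y n x) < ennreal \<epsilon>))"
proof -
  have le: "enn2real (gauge_norm M \<Phi> f) \<le> d \<longleftrightarrow> gauge_norm M \<Phi> f \<le> ennreal d"
    and lt: "enn2real (gauge_norm M \<Phi> f) < d \<longleftrightarrow> gauge_norm M \<Phi> f < ennreal d"
    if f: "f \<in> orlicz_fun M \<Phi>" "0 < d" for f d
  proof -
    obtain r where "0 \<le> r" "gauge_norm M \<Phi> f = ennreal r"
      using f by (cases "gauge_norm M \<Phi> f") (auto simp: orlicz_fun_iff_gauge)
    then show "enn2real (gauge_norm M \<Phi> f) \<le> d \<longleftrightarrow> gauge_norm M \<Phi> f \<le> ennreal d"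
      "enn2real (gauge_norm M \<Phi> f) < d \<longleftrightarrow> gauge_norm M \<Phi> f < ennreal d"
      using f by (auto simp: ennreal_less_iff)
  qed
  have pseudo: "norm_sp Y (diff_sp Y (T (orlicz_class M \<Phi> f)) (orlicz_class M \<Phi> g)) \<le> d \<longleftrightarrow>
      gauge_norm M \<Phi> (\<lambda>x. f (E 1 x) - g x) \<le> ennreal d"
    if "f \<in> orlicz_fun M \<Phi>" "g \<in> orlicz_fun M \<Phi>" "0 < d" for f g d
    using that by (simp add: T_class norm_diff_orlicz orlicz_fun_iterate le orlicz_fun_diff)
  have shadow: "norm_sp Y (diff_sp Y (int_iterate (points Y) T n (orlicz_class M \<Phi> f)) (orlicz_class M \<Phi> g)) < d \<longleftrightarrow>
      gauge_norm M \<Phi> (\<lambda>x. f (E n x) - g x) < ennreal d"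
    if "f \<in> orlicz_fun M \<Phi>" "g \<in> orlicz_fun M \<Phi>" "0 < d" for f g d n
    using that by (simp add: iterate_T_class norm_diff_orlicz orlicz_fun_iterate lt orlicz_fun_diff)
  show ?thesis
    unfolding has_shadowing_property_def
  proof (intro all_cong ex_cong1 conj_cong refl, goal_cases)
    case (1 \<epsilon> \<delta>)
    show ?case
    proof (intro iffI allI impI; elim conjE)
      fix y :: "int \<Rightarrow> 'a \<Rightarrow> real"
      assume H: "\<forall>y. (\<forall>n. y n \<in> points Y) \<and> (\<forall>n. norm_sp Y (diff_sp Y (T (y n)) (y (n + 1))) \<le> \<delta>) \<longrightarrow>
          (\<exists>z\<in>points Y. \<forall>n. norm_sp Y (diff_sp Y (int_iterate (points Y) T n z) (y n)) < \<epsilon>)"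
        and y: "\<forall>n. y n \<in> orlicz_fun M \<Phi>" "\<forall>n. gauge_norm M \<Phi> (\<lambda>x. y n (E 1 x) - y (n + 1) x) \<le> ennreal \<delta>"
      obtain Z where Z: "Z \<in> points Y" "\<And>n. norm_sp Y (diff_sp Y (int_iterate (points Y) T n Z) (orlicz_class M \<Phi> (y n))) < \<epsilon>"
        using H[rule_format, of "\<lambda>n. orlicz_class M \<Phi> (y n)"] y pseudo 1 by (auto simp: points_orlicz)
      then obtain z where "z \<in> orlicz_fun M \<Phi>" "Z = orlicz_class M \<Phi> z" by (auto simp: points_orlicz)
      with Z show "\<exists>z\<in>orlicz_fun M \<Phi>. \<forall>n. gauge_norm M \<Phi> (\<lambda>x. z (E n x) - y n x) < ennreal \<epsilon>"
        using shadow y 1 by auto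
    next
      fix y' :: "int \<Rightarrow> ('a \<Rightarrow> real) set"
      assume H: "\<forall>y. (\<forall>n. y n \<in> orlicz_fun M \<Phi>) \<and> (\<forall>n. gauge_norm M \<Phi> (\<lambda>x. y n (E 1 x) - y (n + 1) x) \<le> ennreal \<delta>) \<longrightarrow>
          (\<exists>z\<in>orlicz_fun M \<Phi>. \<forall>n. gauge_norm M \<Phi> (\<lambda>x. z (E n x) - y n x) < ennreal \<epsilon>)"
        and y': "\<forall>n. y' n \<in> points Y" "\<forall>n. norm_sp Y (diff_sp Y (T (y' n)) (y' (n + 1))) \<le> \<delta>"
      from y'(1) have "\<forall>n. \<exists>f. f \<in> orlicz_fun M \<Phi> \<and> y' n = orlicz_class M \<Phi> f" by (auto simp: points_orlicz)
      then obtain y where y: "\<And>n. y n \<in> orlicz_fun M \<Phi>" "\<And>n. y' n = orlicz_class M \<Phi> (y n)" by metis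
      obtain z where z: "z \<in> orlicz_fun M \<Phi>" "\<And>n. gauge_norm M \<Phi> (\<lambda>x. z (E n x) - y n x) < ennreal \<epsilon>"
        using H[rule_format, of y] y y'(2) pseudo 1 by auto
      then show "\<exists>z\<in>points Y. \<forall>n. norm_sp Y (diff_sp Y (int_iterate (points Y) T n z) (y' n)) < \<epsilon>"
        using shadow y 1 by (intro bexI[of _ "orlicz_class M \<Phi> z"]) (auto simp: points_orlicz)
    qed
  qed
qed

end

section \<open>Contracted splittings and shadowing\<close>

context young_fn
begin

text \<open>
The sequence \<open>w\<close> bounds the norms of the operators f \<mapsto> (\<chi>_A f) \<circ> S_j. Modulars express
this without reference to the gauge, and summability is all that the correction of pseudo-orbits uses.
\<close>

definition summably_contracted :: "'a measure \<Rightarrow> (nat \<Rightarrow> 'a \<Rightarrow> 'a) \<Rightarrow> 'a set \<Rightarrow> bool" where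
  "summably_contracted M S A \<longleftrightarrow>
     (\<exists>w. (\<forall>j. 0 < w j) \<and> summable w \<and>
       (\<forall>g\<in>borel_measurable M. modular M g \<le> 1 \<longrightarrow>
         (\<forall>j. modular M (\<lambda>x. indicator A (S j x) * g (S j x) / w j) \<le> 1)))"

lemma summably_contracted_subset:
  assumes "summably_contracted M S A" "B \<subseteq> A"
  shows "summably_contracted M S B"
proof -
  from assms(1) obtain w where w: "\<And>j. 0 < w j" "summable w"
    and le: "\<And>g j. g \<in> borel_measurable M \<Longrightarrow> modular M g \<le> 1 \<Longrightarrow>
      modular M (\<lambda>x. indicator A (S j x) * g (S j x) / w j) \<le> 1"
    unfolding summably_contracted_def by blast
  have "modular M (\<lambda>x. indicator B (S j x) * g (S j x) / w j) \<le> 1"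
    if "g \<in> borel_measurable M" "modular M g \<le> 1" for g j
  proof -
    have "modular M (\<lambda>x. indicator B (S j x) * g (S j x) / w j) \<le>
        modular M (\<lambda>x. indicator A (S j x) * g (S j x) / w j)"
      using assms(2) by (intro nn_integral_mono mono_abs) (auto simp: indicator_def)
    also have "\<dots> \<le> 1" by (rule le) fact+
    finally show ?thesis .
  qed
  with w show ?thesis unfolding summably_contracted_def by blast
qed

lemma summably_contracted_empty: "summably_contracted M S {}"
  unfolding summably_contracted_def
  by (intro exI[of _ "\<lambda>j. (1/2) ^ j"]) (auto intro: summable_geometric)

end

context orlicz_action
begin

lemma series_of_errors:
  assumes S [measurable]: "\<And>j. S j \<in> measurable M M" and A [measurable]: "A \<in> sets M"
    and w: "\<And>j. 0 < w j" "summable w"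
    and le: "\<And>g j. g \<in> borel_measurable M \<Longrightarrow> modular M g \<le> 1 \<Longrightarrow>
      modular M (\<lambda>x. indicator A (S j x) * g (S j x) / w j) \<le> 1"
    and e [measurable]: "\<And>j. e j \<in> borel_measurable M"
    and d: "0 < d" "\<And>j. modular M (\<lambda>x. e j x / d) \<le> 1"
  shows "AE x in M. summable (\<lambda>j. indicator A (S j x) * e j (S j x))"
    and "modular M (\<lambda>x. (\<Sum>j. indicator A (S j x) * e j (S j x)) / (2 * d * suminf w)) \<le> 1"
proof -
  have m: "(\<lambda>x. indicator A (S j x) * e j (S j x)) \<in> borel_measurable M" for j by measurable
  have c: "0 < d * w j" "summable (\<lambda>j. d * w j)" for j using w d by auto
  have l: "modular M (\<lambda>x. indicator A (S j x) * e j (S j x) / (d * w j)) \<le> 1" for j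
    using le[of "\<lambda>x. e j x / d" j] d(2) by simp
  show "AE x in M. summable (\<lambda>j. indicator A (S j x) * e j (S j x))"
    by (rule series_modular(1)[OF m c l])
  have "suminf (\<lambda>j. d * w j) = d * suminf w" using w by (intro suminf_mult)
  then show "modular M (\<lambda>x. (\<Sum>j. indicator A (S j x) * e j (S j x)) / (2 * d * suminf w)) \<le> 1"
    using series_modular(2)[OF m c l] by (simp add: mult.assoc)
qed

text \<open>
Let e_n=Ty_n-y_(n+1) be the errors of a pseudo-orbit. The correction

D_n = P_n - Q_n, P_n = \<Sum>_(j \<ge> 0) T^j(\<chi>_A e_(n-1-j)), Q_n = \<Sum>_(j \<ge> 0) T^(-j-1)(\<chi>_B e_(n+j))

solves T D_n = D_(n+1) - e_n, because T P_n is P_(n+1) without its term \<chi>_A e_n, and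
T Q_n is Q_(n+1) with \<chi>_B e_n added. Hence y_n+D_n is an exact orbit, and
D_n is small uniformly in n by the summable bounds. Errors on \<open>A\<close> are propagated forwards
and errors on \<open>B\<close> backwards, each in the direction in which they decay.
\<close>

theorem splitting_imp_shadowing:
  assumes A [measurable]: "A \<in> sets M" and B [measurable]: "B \<in> sets M"
    and AB: "A \<inter> B = {}" "A \<union> B = space M"
    and conA: "summably_contracted M (\<lambda>j. E (int j)) A"
    and conB: "summably_contracted M (\<lambda>j. E (- int j)) B"
  shows "has_shadowing_property Y T"
  unfolding shadowing_iff_functions
proof (intro allI impI)
  fix \<epsilon> :: real assume \<epsilon>: "0 < \<epsilon>"
  obtain w where w: "\<And>j. 0 < w j" "summable w"
    and wle: "\<And>g j. g \<in> borel_measurable M \<Longrightarrow> modular M g \<le> 1 \<Longrightarrow>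
      modular M (\<lambda>x. indicator A (E (int j) x) * g (E (int j) x) / w j) \<le> 1"
    using conA unfolding summably_contracted_def by blast
  obtain v' where v': "\<And>j. 0 < v' j" "summable v'"
    and v'le: "\<And>g j. g \<in> borel_measurable M \<Longrightarrow> modular M g \<le> 1 \<Longrightarrow>
      modular M (\<lambda>x. indicator B (E (- int j) x) * g (E (- int j) x) / v' j) \<le> 1"
    using conB unfolding summably_contracted_def by blast
  \<comment> \<open>The backward series starts with one application of the inverse, hence the shift of the weights.\<close>
  define v where "v j = v' (Suc j)" for j
  have v: "\<And>j. 0 < v j" "summable v"
    using v' summable_Suc_iff[of v'] by (auto simp: v_def[abs_def])
  have vle: "modular M (\<lambda>x. indicator B (E (- int (Suc j)) x) * g (E (- int (Suc j)) x) / v j) \<le> 1"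
    if "g \<in> borel_measurable M" "modular M g \<le> 1" for g j
    using v'le[OF that, of "Suc j"] by (simp add: v_def)
  define C where "C = suminf w + suminf v"
  have pos: "0 < suminf w" "0 < suminf v" using w v by (auto intro!: suminf_pos)
  \<comment> \<open>The corrections below have gauge at most \<open>8 * \<delta> * C\<close>: a factor 2 for passing from gauges of errors to
    modulars, 2 from each series, and 2 from adding the two series.\<close>
  define \<delta> where "\<delta> = \<epsilon> / (16 * C)"
  have C: "0 < C" "suminf w \<le> C" "suminf v \<le> C" using pos by (auto simp: C_def)
  have \<delta>: "0 < \<delta>" using \<epsilon> C by (simp add: \<delta>_def)
  show "\<exists>\<delta>>0. \<forall>y. (\<forall>n. y n \<in> orlicz_fun M \<Phi>) \<and>
      (\<forall>n. gauge_norm M \<Phi> (\<lambda>x. y n (E 1 x) - y (n + 1) x) \<le> ennreal \<delta>) \<longrightarrow>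
      (\<exists>z\<in>orlicz_fun M \<Phi>. \<forall>n::int. gauge_norm M \<Phi> (\<lambda>x. z (E n x) - y n x) < ennreal \<epsilon>)"
  proof (intro exI[of _ \<delta>] conjI \<delta> allI impI; elim conjE)
    fix y :: "int \<Rightarrow> 'a \<Rightarrow> real"
    assume y: "\<forall>n. y n \<in> orlicz_fun M \<Phi>"
      and err: "\<forall>n. gauge_norm M \<Phi> (\<lambda>x. y n (E 1 x) - y (n + 1) x) \<le> ennreal \<delta>"
    have [measurable]: "y n \<in> borel_measurable M" for n using y by (auto simp: orlicz_fun_def)
    define e where "e n x = y n (E 1 x) - y (n + 1) x" for n x
    have e [measurable]: "e n \<in> borel_measurable M" for n unfolding e_def by measurable
    have ele: "modular M (\<lambda>x. e n x / (2 * \<delta>)) \<le> 1" for n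
    proof (rule modular_le_1)
      have "gauge_norm M \<Phi> (e n) \<le> ennreal \<delta>" using err by (simp add: e_def[abs_def])
      also have "\<dots> < ennreal (2 * \<delta>)" using \<delta> by (simp add: ennreal_less_iff)
      finally show "gauge_norm M \<Phi> (e n) < ennreal (2 * \<delta>)" .
    qed
    define p where "p n j x = indicator A (E (int j) x) * e (n - 1 - int j) (E (int j) x)" for n j x
    define q where "q n j x = indicator B (E (- int (Suc j)) x) * e (n + int j) (E (- int (Suc j)) x)" for n j x
    have [measurable]: "p n j \<in> borel_measurable M" "q n j \<in> borel_measurable M" for n j
      unfolding p_def q_def by measurable
    note P = series_of_errors[OF E_measurable A w wle e _ ele]
    note Q = series_of_errors[OF E_measurable B v vle e _ ele]
    have sump: "AE x in M. summable (\<lambda>j. p n j x)" for n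
      unfolding p_def using P(1) \<delta> by simp
    have sumq: "AE x in M. summable (\<lambda>j. q n j x)" for n
      unfolding q_def using Q(1) \<delta> by simp
    have modp: "modular M (\<lambda>x. (\<Sum>j. p n j x) / (4 * \<delta> * suminf w)) \<le> 1" for n
      using P(2)[of "\<lambda>j. n - 1 - int j"] \<delta> by (simp add: p_def)
    have modq: "modular M (\<lambda>x. (\<Sum>j. q n j x) / (4 * \<delta> * suminf v)) \<le> 1" for n
      using Q(2)[of "\<lambda>j. n + int j"] \<delta> by (simp add: q_def)
    define D where "D n x = (\<Sum>j. p n j x) - (\<Sum>j. q n j x)" for n x
    have [measurable]: "D n \<in> borel_measurable M" for n unfolding D_def by measurable
    have D_gauge: "gauge_norm M \<Phi> (D n) < ennreal \<epsilon>" for n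
    proof -
      define m where "m = 4 * \<delta> * C"
      have m: "0 < m" "2 * m < \<epsilon>" using \<delta> C \<epsilon> by (auto simp: m_def \<delta>_def)
      have "modular M (\<lambda>x. D n x / (2 * m)) \<le> (\<integral>\<^sup>+x. ennreal (1/2) * \<Phi> ((\<Sum>j. p n j x) / (4 * \<delta> * suminf w)) +
          ennreal (1/2) * \<Phi> ((\<Sum>j. q n j x) / (4 * \<delta> * suminf v)) \<partial>M)"
      proof (rule nn_integral_mono)
        fix x
        have *: "\<Phi> (a / m) \<le> \<Phi> (a / (4 * \<delta> * s))" if "0 < s" "s \<le> C" for a s
          using that \<delta> C unfolding m_def
          by (intro mono_abs) (auto simp: abs_divide abs_mult intro!: divide_left_mono mult_left_mono)
        have "\<Phi> (D n x / (2 * m)) = \<Phi> (((\<Sum>j. p n j x) / m + (- (\<Sum>j. q n j x) / m)) / 2)"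
          by (simp add: D_def diff_divide_distrib mult.commute)
        also have "\<dots> \<le> ennreal (1/2) * \<Phi> ((\<Sum>j. p n j x) / m) + ennreal (1/2) * \<Phi> (- (\<Sum>j. q n j x) / m)"
          by (rule half_sum_le)
        also have "\<Phi> (- (\<Sum>j. q n j x) / m) = \<Phi> ((\<Sum>j. q n j x) / m)"
          using even[of "(\<Sum>j. q n j x) / m"] by simp
        also have "ennreal (1/2) * \<Phi> ((\<Sum>j. p n j x) / m) + ennreal (1/2) * \<Phi> ((\<Sum>j. q n j x) / m) \<le>
          ennreal (1/2) * \<Phi> ((\<Sum>j. p n j x) / (4 * \<delta> * suminf w)) +
          ennreal (1/2) * \<Phi> ((\<Sum>j. q n j x) / (4 * \<delta> * suminf v))"
          using pos C by (intro add_mono mult_left_mono *) auto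
        finally show "\<Phi> (D n x / (2 * m)) \<le> \<dots>" .
      qed
      also have "\<dots> = ennreal (1/2) * modular M (\<lambda>x. (\<Sum>j. p n j x) / (4 * \<delta> * suminf w)) +
          ennreal (1/2) * modular M (\<lambda>x. (\<Sum>j. q n j x) / (4 * \<delta> * suminf v))"
        by (subst nn_integral_add) (auto simp: nn_integral_cmult)
      also have "\<dots> \<le> ennreal (1/2) * 1 + ennreal (1/2) * 1"
        by (intro add_mono mult_left_mono modp modq) auto
      also have "\<dots> = 1" unfolding mult_1_right by (subst ennreal_plus[symmetric]) auto
      finally have "gauge_norm M \<Phi> (D n) \<le> ennreal (2 * m)" using m by (intro gauge_le) auto
      also have "\<dots> < ennreal \<epsilon>" using m by (simp add: ennreal_less_iff)
      finally show ?thesis .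
    qed
    have D_orlicz: "D n \<in> orlicz_fun M \<Phi>" for n
      using D_gauge[of n] by (auto simp: orlicz_fun_iff_gauge intro: less_trans)
    define h where "h n x = y n x + D n x" for n x
    have step: "AE x in M. h (n + 1) x = h n (E 1 x)" for n
      using AE_iterate[OF sump[of n], of 1] AE_iterate[OF sumq[of n], of 1] sump[of "n + 1"] sumq[of "n + 1"] AE_space
    proof eventually_elim
      case (elim x)
      have p: "p n j (E 1 x) = p (n + 1) (Suc j) x" for j
        using elim(5) by (simp add: p_def E_add algebra_simps)
      have q: "q n (Suc j) (E 1 x) = q (n + 1) j x" for j
        using elim(5) by (simp add: q_def E_add algebra_simps)
      have p0: "p (n + 1) 0 x = indicator A x * e n x" using elim(5) by (simp add: p_def E_zero)
      have q0: "q n 0 (E 1 x) = indicator B x * e n x" using elim(5) by (simp add: q_def E_add E_zero)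
      have "(\<Sum>j. p n j (E 1 x)) = (\<Sum>j. p (n + 1) j x) - indicator A x * e n x"
        using suminf_split_head[OF elim(3)] by (simp add: p p0)
      moreover have "(\<Sum>j. q n j (E 1 x)) = (\<Sum>j. q (n + 1) j x) + indicator B x * e n x"
        using suminf_split_head[OF elim(2)] by (simp add: q q0)
      moreover have "indicator A x * e n x + indicator B x * e n x = e n x"
        using AB elim(5) by (auto simp: indicator_def)
      ultimately have "D n (E 1 x) = D (n + 1) x - e n x" by (simp add: D_def)
      then show ?case by (simp add: h_def e_def)
    qed
    have orbit: "AE x in M. h n x = h 0 (E n x)" for n
    proof (induction n rule: int_induct[where k = 0])
      case base
      show ?case by (rule AE_I2) (simp add: E_zero)
    next
      case (step1 i)
      from step[of i] AE_iterate[OF step1(2), of 1] AE_space show ?case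
        by eventually_elim (simp add: E_add add.commute)
    next
      case (step2 i)
      from AE_iterate[OF step[of "i - 1"], of "-1"] AE_iterate[OF step2(2), of "-1"] AE_space show ?case
        by eventually_elim (simp add: E_add E_zero)
    qed
    show "\<exists>z\<in>orlicz_fun M \<Phi>. \<forall>n. gauge_norm M \<Phi> (\<lambda>x. z (E n x) - y n x) < ennreal \<epsilon>"
    proof (intro bexI[of _ "h 0"] allI)
      show "h 0 \<in> orlicz_fun M \<Phi>"
        unfolding h_def[abs_def] using y D_orlicz by (intro orlicz_fun_add) auto
      fix n
      have "AE x in M. h 0 (E n x) - y n x = D n x"
        using orbit[of n] by eventually_elim (simp add: h_def)
      then have "gauge_norm M \<Phi> (\<lambda>x. h 0 (E n x) - y n x) = gauge_norm M \<Phi> (D n)"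
        by (rule gauge_cong_AE)
      with D_gauge[of n] show "gauge_norm M \<Phi> (\<lambda>x. h 0 (E n x) - y n x) < ennreal \<epsilon>" by simp
    qed
  qed
qed

text \<open>
The image of a function under g \<mapsto> (\<chi>_A g) \<circ> E_N vanishes off \<open>A\<close> again, so the step can be
iterated and gains a factor 2 each time. The remaining fewer than \<open>N\<close> steps cost at most
c^N.
\<close>

lemma summably_contracted_of_step:
  assumes A [measurable]: "A \<in> sets M" and N: "0 < N"
    and inv: "\<And>x j. x \<in> space M \<Longrightarrow> E (int j) x \<in> A \<Longrightarrow> x \<in> A"
    and step: "\<And>g. g \<in> borel_measurable M \<Longrightarrow> modular M g \<le> 1 \<Longrightarrow>
      modular M (\<lambda>x. 2 * (indicator A (E (int N) x) * g (E (int N) x))) \<le> 1"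
  shows "summably_contracted M (\<lambda>j. E (int j)) A"
proof -
  obtain \<theta> :: real where \<theta>: "0 < \<theta>" "\<theta> < 1" "\<And>j. (1/2) ^ (j div N) \<le> 2 * \<theta> ^ j"
    using half_power_div_le[OF N] by blast
  define w where "w j = 2 * c ^ N * \<theta> ^ j" for j
  have w: "0 < w j" "summable w" for j
    using \<theta> c_ge_1 unfolding w_def by (auto intro!: summable_mult summable_geometric)
  have "modular M (\<lambda>x. indicator A (E (int j) x) * g (E (int j) x) / w j) \<le> 1"
    if [measurable]: "g \<in> borel_measurable M" and g: "modular M g \<le> 1" for g j
  proof -
    define u where "u i x = 2 ^ i * (indicator A (E (int (i * N)) x) * g (E (int (i * N)) x))" for i x
    have [measurable]: "u i \<in> borel_measurable M" for i unfolding u_def by measurable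
    have iter: "modular M (u i) \<le> 1" for i
    proof (induction i)
      case 0
      have "modular M (u 0) \<le> modular M g"
        by (intro nn_integral_mono mono_abs) (auto simp: u_def indicator_def E_zero)
      with g show ?case by simp
    next
      case (Suc i)
      have "modular M (u (Suc i)) = modular M (\<lambda>x. 2 * (indicator A (E (int N) x) * u i (E (int N) x)))"
      proof (rule nn_integral_cong)
        fix x assume x: "x \<in> space M"
        have eq: "E (int (i * N)) (E (int N) x) = E (int (Suc i * N)) x"
          using x by (simp add: E_add algebra_simps)
        have "E (int (Suc i * N)) x \<in> A \<Longrightarrow> E (int N) x \<in> A"
          using inv[of "E (int N) x" "i * N"] E_space[OF x] by (simp only: eq)
        then show "\<Phi> (u (Suc i) x) = \<Phi> (2 * (indicator A (E (int N) x) * u i (E (int N) x)))"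
          unfolding u_def eq by (auto simp: indicator_def mult.assoc)
      qed
      also have "\<dots> \<le> 1" using Suc by (intro step) auto
      finally show ?case .
    qed
    define i r where "i = j div N" and "r = j mod N"
    have j: "j = r + i * N" and r: "r < N" using N by (auto simp: i_def r_def)
    have cr: "1 \<le> c ^ r" "c ^ r \<le> c ^ N" using c_ge_1 r by (auto intro: one_le_power power_increasing)
    have "modular M (\<lambda>x. indicator A (E (int j) x) * g (E (int j) x) / w j) \<le>
        modular M (\<lambda>x. u i (E (int r) x) / c ^ r)"
    proof (rule nn_integral_mono)
      fix x assume x: "x \<in> space M"
      define t where "t = indicator A (E (int j) x) * g (E (int j) x)"
      have eq: "E (int (i * N)) (E (int r) x) = E (int j) x"
        using x by (simp add: E_add j algebra_simps)
      have "c ^ r * (1/2) ^ i \<le> c ^ N * (2 * \<theta> ^ j)"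
        using cr \<theta> c_ge_1 unfolding i_def by (intro mult_mono) auto
      then have "c ^ r / 2 ^ i \<le> w j" by (simp add: w_def power_one_over field_simps)
      then have "\<bar>t\<bar> / w j \<le> \<bar>t\<bar> / (c ^ r / 2 ^ i)"
        by (rule divide_left_mono) (use w(1)[of j] c_ge_1 in auto)
      then have "\<bar>t / w j\<bar> \<le> \<bar>t\<bar> / (c ^ r / 2 ^ i)" using w(1)[of j] by (simp add: abs_divide)
      also have "\<dots> = \<bar>u i (E (int r) x) / c ^ r\<bar>"
        unfolding u_def eq t_def[symmetric] using c_ge_1 by (simp add: abs_mult)
      finally show "\<Phi> (indicator A (E (int j) x) * g (E (int j) x) / w j) \<le> \<Phi> (u i (E (int r) x) / c ^ r)"
        unfolding t_def[symmetric] by (rule mono_abs)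
    qed
    also have "\<dots> \<le> ennreal (c ^ r) * modular M (\<lambda>x. u i x / c ^ r)"
      using modular_iterate_le[of "\<lambda>x. u i x / c ^ r" "int r"] by simp
    also have "modular M (\<lambda>x. u i x / c ^ r) \<le> (\<integral>\<^sup>+x. ennreal (1 / c ^ r) * \<Phi> (u i x) \<partial>M)"
      using scale_le[of "1 / c ^ r" "u i x" for x] cr by (intro nn_integral_mono) auto
    also have "\<dots> = ennreal (1 / c ^ r) * modular M (u i)" by (rule nn_integral_cmult) auto
    also have "\<dots> \<le> ennreal (1 / c ^ r) * 1" by (intro mult_left_mono iter) auto
    also have "ennreal (c ^ r) * (ennreal (1 / c ^ r) * 1) = 1"
      using cr c_ge_1 by (simp flip: ennreal_mult)
    finally show ?thesis by (simp add: mult_left_mono)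
  qed
  with w show ?thesis unfolding summably_contracted_def by blast
qed

end

section \<open>Dissipative systems of bounded distortion\<close>

context orlicz_action
begin

lemma image_E: "G \<subseteq> space M \<Longrightarrow> E k ` G = E (- k) -` G \<inter> space M"
proof (intro equalityI subsetI)
  fix x assume G: "G \<subseteq> space M" and "x \<in> E k ` G"
  then obtain y where "y \<in> G" "x = E k y" by blast
  with G show "x \<in> E (- k) -` G \<inter> space M" by (auto simp: E_add E_zero E_space subset_iff)
next
  fix x assume "x \<in> E (- k) -` G \<inter> space M"
  then show "x \<in> E k ` G" by (intro image_eqI[of _ _ "E (- k) x"]) (auto simp: E_add E_zero)
qed

lemma sets_image_E: "G \<in> sets M \<Longrightarrow> E k ` G \<in> sets M"
  using sets.sets_into_space[of G M] by (subst image_E) (auto intro: measurable_sets)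

lemma image_image_E: "G \<subseteq> space M \<Longrightarrow> E j ` E k ` G = E (j + k) ` G"
  by (auto simp: image_image E_add subset_iff intro!: image_cong)

lemma image_E_zero: "G \<subseteq> space M \<Longrightarrow> E 0 ` G = G"
  by (force simp: E_zero subset_iff image_iff)

lemma emeasure_image_le:
  assumes "G \<in> sets M" shows "emeasure M (E k ` G) \<le> ennreal (c ^ nat \<bar>k\<bar>) * emeasure M G"
  using emeasure_iterate_le[OF assms, of "- k"] image_E[of G k] sets.sets_into_space[OF assms] by simp

lemma emeasure_image_pos:
  assumes G: "G \<in> sets M" "0 < emeasure M G" shows "0 < emeasure M (E k ` G)"
proof (rule ccontr)
  assume "\<not> 0 < emeasure M (E k ` G)"
  moreover have "emeasure M (E (- k) ` E k ` G) \<le> ennreal (c ^ nat \<bar>- k\<bar>) * emeasure M (E k ` G)"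
    by (intro emeasure_image_le sets_image_E G)
  moreover have "E (- k) ` E k ` G = G"
    using sets.sets_into_space[OF G(1)] by (simp add: image_image_E image_E_zero)
  ultimately show False using G by simp
qed

lemma emeasure_image_finite:
  assumes "G \<in> sets M" "emeasure M G < \<infinity>" shows "emeasure M (E k ` G) < \<infinity>"
  using emeasure_image_le[OF assms(1), of k] assms(2)
  by (auto simp: ennreal_mult_less_top intro: le_less_trans)

end

text \<open>
The two distortion inequalities are those for gauges of indicators, with gauges replaced by the
reciprocal levels.
\<close>

locale wandering_system = orlicz_action \<Phi> M E c + proper_young_fn \<Phi>
  for \<Phi> and M :: "'a measure" and E c +
  fixes W :: "'a set" and K :: real
  assumes W_sets [measurable]: "W \<in> sets M"
    and W_pos: "0 < emeasure M W" and W_finite: "emeasure M W < \<infinity>"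
    and W_disjoint: "disjoint_family (\<lambda>k. E k ` W)"
    and W_cover: "(\<Union>k. E k ` W) = space M"
    and K_ge_1: "1 \<le> K"
    and distortion_upper: "\<And>k G. G \<in> sets M \<Longrightarrow> G \<subseteq> W \<Longrightarrow> 0 < emeasure M G \<Longrightarrow>
      level M (E k ` G) * level M W \<le> K * (level M (E k ` W) * level M G)"
    and distortion_lower: "\<And>k G. G \<in> sets M \<Longrightarrow> G \<subseteq> W \<Longrightarrow> 0 < emeasure M G \<Longrightarrow>
      level M (E k ` W) * level M G \<le> K * (level M (E k ` G) * level M W)"
begin

lemma W_space: "W \<subseteq> space M" using sets.sets_into_space[OF W_sets] .

lemma level_pos:
  assumes "0 < emeasure M F" "emeasure M F < \<infinity>" shows "0 < level M F"
  unfolding level_def using assms by (intro inverse_pos) (simp add: measure_def enn2real_positive_iff)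

definition a :: "int \<Rightarrow> real" where "a k = level M (E k ` W)"

lemma a_pos: "0 < a k"
  unfolding a_def by (intro level_pos emeasure_image_pos emeasure_image_finite W_sets W_pos W_finite)

definition m :: "int \<Rightarrow> real" where "m k = measure M (E k ` W)"

lemma emeasure_m: "emeasure M (E k ` W) = ennreal (m k)"
  using emeasure_image_finite[OF W_sets W_finite, of k] by (simp add: m_def emeasure_eq_ennreal_measure)

lemma m_pos: "0 < m k"
  using emeasure_image_pos[OF W_sets W_pos, of k] by (simp add: emeasure_m)

lemma a_eq: "a k = inv_\<Phi> (1 / m k)"
  by (simp add: a_def m_def level_def)

lemma m_shift: "m (k + j) \<le> c ^ nat \<bar>j\<bar> * m k"
proof -
  have "emeasure M (E j ` E k ` W) \<le> ennreal (c ^ nat \<bar>j\<bar>) * emeasure M (E k ` W)"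
    by (intro emeasure_image_le sets_image_E W_sets)
  then show ?thesis
    using c_ge_1 m_pos[of k] by (simp add: image_image_E W_space emeasure_m add.commute flip: ennreal_mult)
qed

lemma a_ratio: "a k \<le> c ^ nat \<bar>j\<bar> * a (k + j)"
proof -
  define C where "C = c ^ nat \<bar>j\<bar>"
  have C: "1 \<le> C" using c_ge_1 by (simp add: C_def)
  have "1 / m k \<le> C / m (k + j)"
    using m_shift[of k j] m_pos[of k] m_pos[of "k + j"] by (simp add: C_def field_simps)
  then have "a k \<le> inv_\<Phi> (C / m (k + j))" unfolding a_eq by (rule inverse_mono)
  moreover have "(1 / m (k + j)) / (C / m (k + j)) * inv_\<Phi> (C / m (k + j)) \<le> inv_\<Phi> (1 / m (k + j))"
    using m_pos[of "k + j"] C by (intro inverse_concave divide_right_mono) auto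
  ultimately show ?thesis using m_pos[of "k + j"] C by (simp add: a_eq field_simps flip: C_def)
qed

text \<open>
Write F=\<phi>^k(G) with G \<subseteq> W. Distortion compares the levels of F and of
\<phi>^(-n)F=\<phi>^(k-n)(G) with the level of G, once each, which costs K^2. Since the
resulting factor is smaller than 1, the comparison descends from levels to measures.
\<close>

lemma measure_contraction_piece:
  assumes F: "F \<in> sets M" "F \<subseteq> E k ` W" and r: "a k \<le> r * a (k - int n)" "K\<^sup>2 * r < 1"
  shows "emeasure M (E (int n) -` F \<inter> space M) \<le> ennreal (K\<^sup>2 * r) * emeasure M F"
proof (cases "emeasure M F = 0")
  case True
  then show ?thesis using emeasure_iterate_le[OF F(1), of "int n"] by simp
next
  case False
  have Fs: "F \<subseteq> space M" using sets.sets_into_space[OF F(1)] .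
  define G where "G = E (- k) ` F"
  have G: "G \<in> sets M" unfolding G_def by (intro sets_image_E F)
  have Fpos: "0 < emeasure M F" using False by (simp add: zero_less_iff_neq_zero)
  have Gpos: "0 < emeasure M G" unfolding G_def by (intro emeasure_image_pos F Fpos)
  have "G \<subseteq> E (- k) ` E k ` W" unfolding G_def using F by (intro image_mono)
  then have GW: "G \<subseteq> W" by (simp add: image_image_E image_E_zero W_space)
  have FG: "E k ` G = F" unfolding G_def using Fs by (simp add: image_image_E image_E_zero)
  define F' where "F' = E (int n) -` F \<inter> space M"
  have "F' = E (- int n) ` F" unfolding F'_def using image_E[OF Fs, of "- int n"] by simp
  then have F'G: "F' = E (k - int n) ` G"
    unfolding G_def using Fs by (simp add: image_image_E)
  have Gfin: "emeasure M G < \<infinity>" using emeasure_mono[OF GW W_sets] W_finite by (rule le_less_trans)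
  have pF: "0 < emeasure M F" "emeasure M F < \<infinity>"
    using Fpos emeasure_image_finite[OF G Gfin, of k] by (simp_all add: FG)
  have pF': "0 < emeasure M F'" "emeasure M F' < \<infinity>"
    using emeasure_image_pos[OF G Gpos, of "k - int n"] emeasure_image_finite[OF G Gfin, of "k - int n"]
    by (simp_all add: F'G)
  note lp = level_pos[OF pF] level_pos[OF pF'] level_pos[OF Gpos Gfin] level_pos[OF W_pos W_finite]
  have up: "level M F * level M W \<le> K * (a k * level M G)"
    using distortion_upper[OF G GW Gpos, of k] by (simp add: FG a_def)
  have lo: "a (k - int n) * level M G \<le> K * (level M F' * level M W)"
    using distortion_lower[OF G GW Gpos, of "k - int n"] by (simp add: F'G a_def)
  have r0: "0 < r" using r(1) a_pos[of k] a_pos[of "k - int n"] by (metis less_le_trans zero_less_mult_pos2)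
  have "level M F * level M W \<le> K * (a k * level M G)" by (rule up)
  also have "\<dots> \<le> K * (r * a (k - int n) * level M G)"
    using r(1) lp K_ge_1 by (intro mult_left_mono mult_right_mono) auto
  also have "\<dots> = K * r * (a (k - int n) * level M G)" by simp
  also have "\<dots> \<le> K * r * (K * (level M F' * level M W))"
    using lo K_ge_1 r0 by (intro mult_left_mono) auto
  also have "\<dots> = (K\<^sup>2 * r * level M F') * level M W" by (simp add: power2_eq_square)
  finally have "level M F \<le> K\<^sup>2 * r * level M F'" using lp by simp
  then have lvl: "inv_\<Phi> (1 / measure M F) \<le> K\<^sup>2 * r * inv_\<Phi> (1 / measure M F')"
    by (simp add: level_def)
  have mpos: "0 < measure M F" "0 < measure M F'"
    using pF pF' by (simp_all add: measure_def enn2real_positive_iff)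
  have "1 / measure M F \<le> K\<^sup>2 * r * (1 / measure M F')"
    by (rule inverse_less_imp_ratio[OF _ _ r(2) lvl]) (use mpos in simp_all)
  then have "measure M F' \<le> K\<^sup>2 * r * measure M F" using mpos by (simp add: field_simps)
  moreover have "emeasure M F = ennreal (measure M F)" "emeasure M F' = ennreal (measure M F')"
    using pF pF' by (simp_all add: emeasure_eq_ennreal_measure)
  ultimately show ?thesis
    unfolding F'_def[symmetric] using r0 mpos by (simp flip: ennreal_mult)
qed

definition blocks :: "int set \<Rightarrow> 'a set" where "blocks I = (\<Union>k\<in>I. E k ` W)"

lemma blocks_sets [measurable]: "blocks I \<in> sets M"
  unfolding blocks_def by (intro sets.countable_UN'') (auto intro: sets_image_E)

lemma measure_contraction:
  assumes F: "F \<in> sets M" "F \<subseteq> blocks I"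
    and r: "\<And>k. k \<in> I \<Longrightarrow> a k \<le> r * a (k - int n)" "K\<^sup>2 * r < 1"
  shows "emeasure M (E (int n) -` F \<inter> space M) \<le> ennreal (K\<^sup>2 * r) * emeasure M F"
proof -
  define P where "P k = F \<inter> E k ` W" for k
  have P: "P k \<in> sets M" for k unfolding P_def by (intro sets.Int F sets_image_E W_sets)
  have disj: "disjoint_family_on P I"
    using W_disjoint unfolding disjoint_family_on_def P_def by blast
  have FP: "F = (\<Union>k\<in>I. P k)" using F(2) by (auto simp: P_def blocks_def)
  have "E (int n) -` F \<inter> space M = (\<Union>k\<in>I. E (int n) -` P k \<inter> space M)" using FP by blast
  also have "emeasure M \<dots> = (\<integral>\<^sup>+k. emeasure M (E (int n) -` P k \<inter> space M) \<partial>count_space I)"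
    using P disj by (intro emeasure_UN_countable) (auto simp: disjoint_family_on_def)
  also have "\<dots> \<le> (\<integral>\<^sup>+k. ennreal (K\<^sup>2 * r) * emeasure M (P k) \<partial>count_space I)"
    using P r by (intro nn_integral_mono measure_contraction_piece) (auto simp: P_def)
  also have "\<dots> = ennreal (K\<^sup>2 * r) * (\<integral>\<^sup>+k. emeasure M (P k) \<partial>count_space I)"
    by (rule nn_integral_cmult) simp
  also have "(\<integral>\<^sup>+k. emeasure M (P k) \<partial>count_space I) = emeasure M F"
    unfolding FP using P disj by (intro emeasure_UN_countable[symmetric]) auto
  finally show ?thesis .
qed

text \<open>
Along the sequence k, k-n, k-2n,... the numbers a grow at least by the factor 4 each time,
while 1/\<mu>(W_k) grows at most by the factor c^n. An x>a_k lies between two consecutive terms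
a_l<x \<le> a_(l-n), so that 2x<a_(l-2n); this gives \<Phi>(x)>1/\<mu>(W_l) and
\<Phi>(2x) \<le> 1/\<mu>(W_(l-2n)) \<le> c^(2n)/\<mu>(W_l).
\<close>

lemma growth_imp_doubling:
  assumes grows: "grows_leftwards a I" and down: "\<And>k n. k \<in> I \<Longrightarrow> k - int n \<in> I"
  shows "\<exists>B. (\<forall>k\<in>I. \<forall>x>a k. \<Phi> (2 * x) \<le> ennreal B * \<Phi> x) \<and> (\<forall>k\<in>I. \<Phi> (2 * a k) < \<infinity>)"
proof -
  obtain q n0 where q: "0 < q" "q < 1" and le: "\<And>n k. n \<ge> n0 \<Longrightarrow> k \<in> I \<Longrightarrow> a k \<le> q ^ n * a (k - int n)"
    using grows unfolding grows_leftwards_def by blast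
  obtain n1 where n1: "q ^ n1 < 1 / 4" using real_arch_pow_inv[of "1/4" q] q by auto
  define n where "n = max n0 n1"
  have "q ^ n \<le> q ^ n1" unfolding n_def using q by (intro power_decreasing) auto
  then have n: "n \<ge> n0" "q ^ n \<le> 1 / 4" using n1 by (simp_all add: n_def)
  have four: "4 * a k \<le> a (k - int n)" if "k \<in> I" for k
  proof -
    have "a k \<le> q ^ n * a (k - int n)" using le n that by blast
    also have "\<dots> \<le> 1 / 4 * a (k - int n)" using n a_pos[of "k - int n"] by (intro mult_right_mono) auto
    finally show ?thesis by simp
  qed
  have iter: "4 ^ j * a k \<le> a (k - int (j * n))" if "k \<in> I" for k j
  proof (induction j)
    case (Suc j)
    have "4 * a (k - int (j * n)) \<le> a (k - int (j * n) - int n)" using four down that by blast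
    also have "k - int (j * n) - int n = k - int (Suc j * n)" by simp
    finally show ?case using Suc by simp
  qed simp
  define B where "B = c ^ (2 * n)"
  have dbl: "\<Phi> (2 * x) \<le> ennreal B * \<Phi> x" if k: "k \<in> I" and x: "a k < x" for k x
  proof -
    have xpos: "0 < x" using a_pos[of k] x by simp
    have "\<exists>j. x \<le> a (k - int (j * n))"
    proof -
      obtain j where "x / a k < 4 ^ j" using real_arch_pow[of 4] by auto
      then have "x \<le> 4 ^ j * a k" using a_pos[of k] by (simp add: field_simps)
      also have "\<dots> \<le> a (k - int (j * n))" by (rule iter[OF k])
      finally show ?thesis ..
    qed
    define j where "j = (LEAST j. x \<le> a (k - int (j * n)))"
    have j: "x \<le> a (k - int (j * n))" unfolding j_def by (rule LeastI_ex) fact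
    have "j \<noteq> 0" using j x by (cases "j = 0") auto
    then obtain i where i: "j = Suc i" by (cases j) auto
    define l where "l = k - int (i * n)"
    have l: "l \<in> I" unfolding l_def by (rule down[OF k])
    have "i < j" by (simp add: i)
    then have "\<not> x \<le> a (k - int (i * n))" unfolding j_def by (rule not_less_Least)
    then have al: "a l < x" by (simp add: l_def)
    have "k - int (j * n) = l - int n" by (simp add: l_def i)
    with j have xl: "x \<le> a (l - int n)" by simp
    have "2 * x < a (l - int n - int n)"
      using four[OF down[OF l, of n]] xl xpos by linarith
    then have "\<Phi> (2 * x) \<le> ennreal (1 / m (l - int n - int n))"
      unfolding a_eq using xpos by (intro below_inverse) auto
    also have "\<dots> \<le> ennreal (B * (1 / m l))"
    proof (rule ennreal_leI)
      have "m l \<le> B * m (l - int n - int n)"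
        using m_shift[of "l - int n - int n" "int (2 * n)"] unfolding B_def nat_int abs_of_nat by (simp add: algebra_simps)
      then show "1 / m (l - int n - int n) \<le> B * (1 / m l)"
        using m_pos[of l] m_pos[of "l - int n - int n"] by (simp add: field_simps)
    qed
    also have "\<dots> = ennreal B * ennreal (1 / m l)"
      using c_ge_1 m_pos[of l] by (intro ennreal_mult) (auto simp: B_def)
    also have "ennreal (1 / m l) \<le> \<Phi> x"
      using above_inverse[of "1 / m l" x] al by (simp add: a_eq)
    finally show ?thesis by (simp add: mult_left_mono)
  qed
  moreover have "\<Phi> (2 * a k) < \<infinity>" if k: "k \<in> I" for k
  proof -
    have "2 * a k < a (k - int n)" using four[OF k] a_pos[of k] by linarith
    then have "\<Phi> (2 * a k) \<le> ennreal (1 / m (k - int n))"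
      unfolding a_eq[of "k - int n"] using a_pos[of k] by (intro below_inverse) auto
    also have "\<dots> < \<infinity>" by simp
    finally show ?thesis .
  qed
  ultimately show ?thesis by blast
qed

lemma power_contraction_eventually_small:
  fixes q :: real
  assumes "0 < q" "q < 1" "0 < e"
  shows "\<exists>n1. \<forall>n\<ge>n1. K\<^sup>2 * q ^ n < e"
proof -
  have "(\<lambda>n. K\<^sup>2 * q ^ n) \<longlonglongrightarrow> K\<^sup>2 * 0"
    using assms by (intro tendsto_intros LIMSEQ_realpow_zero) auto
  then have "\<forall>\<^sub>F n in sequentially. K\<^sup>2 * q ^ n < e" using assms by (intro order_tendstoD) auto
  then show ?thesis by (simp add: eventually_sequentially)
qed

text \<open>
The contraction of measures makes \<mu>(W_(-n)) decay geometrically.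
\<close>

lemma left_half_finite:
  assumes "grows_leftwards a {..0}"
  shows "emeasure M (blocks {..0}) < \<infinity>"
proof -
  obtain q n0 where q: "0 < q" "q < 1" and le: "\<And>n k. n \<ge> n0 \<Longrightarrow> k \<le> 0 \<Longrightarrow> a k \<le> q ^ n * a (k - int n)"
    using assms unfolding grows_leftwards_def by auto
  obtain n1 where n1: "\<And>n. n \<ge> n1 \<Longrightarrow> K\<^sup>2 * q ^ n < 1"
    using power_contraction_eventually_small[OF q, of 1] by auto
  define N where "N = max n0 n1"
  have tail: "m (- int n) \<le> K\<^sup>2 * m 0 * q ^ n" if n: "n \<ge> N" for n
  proof -
    have "emeasure M (E (int n) -` (E 0 ` W) \<inter> space M) \<le> ennreal (K\<^sup>2 * q ^ n) * emeasure M (E 0 ` W)"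
      using n n1 le by (intro measure_contraction_piece sets_image_E W_sets) (auto simp: N_def)
    moreover have "E (int n) -` (E 0 ` W) \<inter> space M = E (- int n) ` W"
      using image_E[of W "- int n"] W_space by (simp add: image_E_zero)
    ultimately show ?thesis using q m_pos[of 0] by (simp add: emeasure_m mult_ac flip: ennreal_mult)
  qed
  have "summable (\<lambda>n. m (- int n))"
  proof (rule summable_comparison_test_ev)
    show "\<forall>\<^sub>F n in sequentially. norm (m (- int n)) \<le> K\<^sup>2 * m 0 * q ^ n"
      using tail m_pos by (auto simp: eventually_sequentially less_imp_le intro!: exI[of _ N])
    show "summable (\<lambda>n. K\<^sup>2 * m 0 * q ^ n)" using q by (intro summable_mult summable_geometric) auto
  qed
  then have fin: "(\<Sum>n. ennreal (m (- int n))) < \<infinity>"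
    using m_pos by (subst suminf_ennreal2) (auto simp: less_imp_le)
  have "blocks {..0} = (\<Union>n. E (- int n) ` W)"
  proof -
    have "{..0::int} = range (\<lambda>n. - int n)"
    proof (intro equalityI subsetI)
      fix x :: int assume "x \<in> {..0}"
      then have "x = - int (nat (- x))" by simp
      then show "x \<in> range (\<lambda>n. - int n)" by (rule range_eqI)
    qed auto
    then show ?thesis unfolding blocks_def by (simp add: image_image)
  qed
  then have "emeasure M (blocks {..0}) \<le> (\<Sum>n. emeasure M (E (- int n) ` W))"
    by (auto intro!: emeasure_subadditive_countably sets_image_E)
  with fin show ?thesis by (simp add: emeasure_m)
qed

text \<open>
The doubling estimate \<Phi>(2x) \<le> B \<Phi>(x) holds for x>x_0 with x_0=0 in the two-sided case,
where a_k tends to 0 as k grows, and with x_0=a_0 in the one-sided case. In the latter the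
values below x_0 contribute at most \<Phi>(2x_0) times the measure of the union of the blocks, which is finite. In both cases the
contraction of measures beats these constants for a large number \<open>N\<close> of steps.
\<close>

theorem growth_imp_contracted:
  assumes grows: "grows_leftwards a I" and I: "I = UNIV \<or> I = {..0}"
  shows "summably_contracted M (\<lambda>j. E (int j)) (blocks I)"
proof -
  have down: "k - int n \<in> I" if "k \<in> I" for k n using that I by auto
  obtain B where B: "\<And>k x. k \<in> I \<Longrightarrow> a k < x \<Longrightarrow> \<Phi> (2 * x) \<le> ennreal B * \<Phi> x"
    and fin: "\<And>k. k \<in> I \<Longrightarrow> \<Phi> (2 * a k) < \<infinity>"
    using growth_imp_doubling[OF grows down] by blast
  obtain q n0 where q: "0 < q" "q < 1" and le: "\<And>n k. n \<ge> n0 \<Longrightarrow> k \<in> I \<Longrightarrow> a k \<le> q ^ n * a (k - int n)"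
    using grows unfolding grows_leftwards_def by blast
  have "\<exists>x0\<ge>0. (\<forall>x>x0. \<Phi> (2 * x) \<le> ennreal B * \<Phi> x) \<and> \<Phi> (2 * x0) * emeasure M (blocks I) < \<infinity>"
  proof (cases "I = UNIV")
    case True
    have "\<exists>k. a k < x" if x: "0 < x" for x
    proof -
      obtain n1 where "q ^ n1 < x / a 0" using real_arch_pow_inv[of "x / a 0" q] q a_pos[of 0] x by auto
      moreover define n where "n = max n0 n1"
      moreover have "q ^ n \<le> q ^ n1" unfolding n_def using q by (intro power_decreasing) auto
      ultimately have "q ^ n < x / a 0" by linarith
      then have "q ^ n * a 0 < x" using a_pos[of 0] by (simp add: field_simps)
      moreover have "a (int n) \<le> q ^ n * a (int n - int n)" using True by (intro le) (auto simp: n_def)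
      ultimately show ?thesis by (intro exI[of _ "int n"]) simp
    qed
    then show ?thesis using B True by (intro exI[of _ 0]) (simp, blast)
  next
    case False
    then have I0: "I = {..0}" using I by blast
    then have "\<Phi> (2 * a 0) * emeasure M (blocks I) < \<infinity>"
      using left_half_finite grows fin[of 0] by (simp add: ennreal_mult_less_top)
    then show ?thesis using B I0 a_pos[of 0] by (intro exI[of _ "a 0"]) auto
  qed
  then obtain x0 where x0: "0 \<le> x0" and B0: "\<And>x. x0 < x \<Longrightarrow> \<Phi> (2 * x) \<le> ennreal B * \<Phi> x"
    and D: "\<Phi> (2 * x0) * emeasure M (blocks I) < \<infinity>" by blast
  obtain d where d: "0 \<le> d" "\<Phi> (2 * x0) * emeasure M (blocks I) = ennreal d"
    using D by (cases "\<Phi> (2 * x0) * emeasure M (blocks I)") auto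
  \<comment> \<open>\<open>d\<close> bounds the contribution of the values below \<open>x0\<close>; \<open>b\<close> is what the measure contraction has to beat.\<close>
  define b where "b = max B 0 + d + 1"
  have b: "1 \<le> b" "max B 0 + d \<le> b" using d by (auto simp: b_def)
  obtain n1 where n1: "\<And>n. n \<ge> n1 \<Longrightarrow> K\<^sup>2 * q ^ n < 1 / b"
    using power_contraction_eventually_small[OF q, of "1 / b"] b by auto
  define N where "N = Suc (max n0 n1)"
  define r where "r = K\<^sup>2 * q ^ N"
  have leN: "a k \<le> q ^ N * a (k - int N)" if "k \<in> I" for k
    using that by (intro le) (simp_all add: N_def del: power_Suc)
  have "N \<ge> n1" by (simp add: N_def)
  then have rb: "r < 1 / b" unfolding r_def by (rule n1)
  have r: "0 \<le> r" "r * b \<le> 1" using rb b q by (simp_all add: r_def field_simps)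
  have "1 / b \<le> 1" using b by simp
  with rb have r1: "K\<^sup>2 * q ^ N < 1" unfolding r_def by linarith
  have Bmax: "ennreal B = ennreal (max B 0)" by (auto simp: max_def ennreal_neg)
  have inv: "x \<in> blocks I" if "x \<in> space M" "E (int j) x \<in> blocks I" for x j
  proof -
    from that obtain k w where k: "k \<in> I" "w \<in> W" "E (int j) x = E k w" by (auto simp: blocks_def)
    have "x = E (- int j) (E (int j) x)" using that by (simp add: E_add E_zero)
    also have "\<dots> = E (k - int j) w" using k W_space by (auto simp: E_add)
    finally show ?thesis using k down by (auto simp: blocks_def)
  qed
  show ?thesis
  proof (rule summably_contracted_of_step[where N = N, OF blocks_sets _ inv])
    show "0 < N" by (simp add: N_def)
    fix g assume [measurable]: "g \<in> borel_measurable M" and g: "modular M g \<le> 1"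
    define h where "h y = ennreal B * \<Phi> (g y) + \<Phi> (2 * x0) * indicator (blocks I) y" for y
    have [measurable]: "h \<in> borel_measurable M" unfolding h_def by measurable
    have "modular M (\<lambda>x. 2 * (indicator (blocks I) (E (int N) x) * g (E (int N) x))) \<le>
        (\<integral>\<^sup>+x. h (E (int N) x) * indicator (blocks I) (E (int N) x) \<partial>M)"
    proof (rule nn_integral_mono)
      fix x
      define y where "y = E (int N) x"
      have "\<Phi> (2 * g y) \<le> ennreal B * \<Phi> (g y) + \<Phi> (2 * x0)"
      proof (cases "x0 < \<bar>g y\<bar>")
        case True
        from B0[OF this] have "\<Phi> (2 * g y) \<le> ennreal B * \<Phi> (g y)"
          using apply_abs[of "2 * g y"] by (simp add: abs_mult)
        then show ?thesis by (rule order_trans) simp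
      next
        case False
        then have "\<Phi> (2 * g y) \<le> \<Phi> (2 * x0)" by (intro mono_abs) (auto simp: abs_mult)
        then show ?thesis by (rule order_trans) simp
      qed
      then show "\<Phi> (2 * (indicator (blocks I) (E (int N) x) * g (E (int N) x))) \<le>
          h (E (int N) x) * indicator (blocks I) (E (int N) x)"
        by (simp add: h_def indicator_def flip: y_def)
    qed
    also have "\<dots> \<le> ennreal (K\<^sup>2 * q ^ N) * (\<integral>\<^sup>+y. h y \<partial>M)"
      using r1 leN by (intro nn_integral_compose_le measure_contraction) auto
    also have "(\<integral>\<^sup>+y. h y \<partial>M) = ennreal B * modular M g + \<Phi> (2 * x0) * emeasure M (blocks I)"
      unfolding h_def by (subst nn_integral_add) (auto simp: nn_integral_cmult nn_integral_cmult_indicator)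
    also have "\<dots> \<le> ennreal (max B 0) * 1 + ennreal d"
      unfolding Bmax d(2) using g by (intro add_mono mult_left_mono) auto
    also have "\<dots> = ennreal (max B 0 + d)" using d by (simp add: ennreal_plus)
    also have "\<dots> \<le> ennreal b" by (intro ennreal_leI b)
    also have "ennreal (K\<^sup>2 * q ^ N) * ennreal b \<le> 1" using r b by (simp flip: r_def ennreal_mult)
    finally show "modular M (\<lambda>x. 2 * (indicator (blocks I) (E (int N) x) * g (E (int N) x))) \<le> 1"
      by (simp add: mult_left_mono)
  qed auto
qed

end

section \<open>From growth to shadowing\<close>

context wandering_system
begin

lemma reversed: "wandering_system \<Phi> M (\<lambda>k. E (- k)) c W K"
proof unfold_locales
  show "disjoint_family (\<lambda>k. E (- k) ` W)"
    using W_disjoint unfolding disjoint_family_on_def by (metis UNIV_I neg_equal_iff_equal)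
  have "(\<Union>k. E (- k) ` W) = (\<Union>k. E k ` W)"
  proof (intro equalityI subsetI)
    fix x assume "x \<in> (\<Union>k. E k ` W)"
    then obtain k where "x \<in> E (- (- k)) ` W" by auto
    then show "x \<in> (\<Union>k. E (- k) ` W)" by blast
  qed auto
  then show "(\<Union>k. E (- k) ` W) = space M" using W_cover by simp
  show "emeasure M (E (- \<sigma>) -` F \<inter> space M) \<le> ennreal c * emeasure M F"
    if "\<sigma> \<in> {1, - 1}" "F \<in> sets M" for \<sigma> F
    using that by (intro domination) auto
qed (auto simp: E_add E_zero c_ge_1 W_pos W_finite[simplified] K_ge_1 distortion_upper distortion_lower)

lemma reversed_a: "wandering_system.a \<Phi> M (\<lambda>k. E (- k)) W = a \<circ> uminus"
  by (simp add: fun_eq_iff wandering_system.a_def[OF reversed] a_def)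

lemma reversed_blocks: "wandering_system.blocks (\<lambda>k. E (- k)) W I = (\<Union>k\<in>I. E (- k) ` W)"
  by (simp add: wandering_system.blocks_def[OF reversed])

lemma blocks_UNIV: "blocks UNIV = space M"
  using W_cover by (simp add: blocks_def)

theorem growth_imp_shadowing:
  assumes "grows_leftwards a UNIV \<or> grows_leftwards (a \<circ> uminus) UNIV \<or>
    grows_leftwards a {..0} \<and> grows_leftwards (a \<circ> uminus) {..0}"
  shows "has_shadowing_property Y T"
proof -
  interpret rev: wandering_system \<Phi> M "\<lambda>k. E (- k)" c W K by (rule reversed)
  consider (left) "grows_leftwards a UNIV" | (right) "grows_leftwards (a \<circ> uminus) UNIV"
    | (valley) "grows_leftwards a {..0}" "grows_leftwards (a \<circ> uminus) {..0}"
    using assms by blast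
  then show ?thesis
  proof cases
    case left
    then have "summably_contracted M (\<lambda>j. E (int j)) (space M)"
      using growth_imp_contracted[of UNIV] by (simp add: blocks_UNIV)
    then show ?thesis
      by (intro splitting_imp_shadowing[of "space M" "{}"] summably_contracted_empty) auto
  next
    case right
    then have "summably_contracted M (\<lambda>j. E (- int j)) (space M)"
      using rev.growth_imp_contracted[of UNIV] by (simp add: rev.blocks_UNIV reversed_a)
    then show ?thesis
      by (intro splitting_imp_shadowing[of "{}" "space M"] summably_contracted_empty) auto
  next
    case valley
    have "summably_contracted M (\<lambda>j. E (int j)) (blocks {..0})"
      using valley growth_imp_contracted[of "{..0}"] by simp
    moreover have "summably_contracted M (\<lambda>j. E (- int j)) (space M - blocks {..0})"
    proof (rule summably_contracted_subset)
      show "summably_contracted M (\<lambda>j. E (- int j)) (rev.blocks {..0})"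
        using valley rev.growth_imp_contracted[of "{..0}"] by (simp add: reversed_a)
      show "space M - blocks {..0} \<subseteq> rev.blocks {..0}"
      proof
        fix x assume x: "x \<in> space M - blocks {..0}"
        then obtain k where k: "x \<in> E k ` W" using W_cover by blast
        with x have "- k \<in> {..0}" by (cases "k \<le> 0") (auto simp: blocks_def)
        moreover have "x \<in> E (- (- k)) ` W" using k by simp
        ultimately show "x \<in> rev.blocks {..0}" unfolding reversed_blocks by blast
      qed
    qed
    moreover have "blocks {..0} \<subseteq> space M" using sets.sets_into_space[OF blocks_sets] .
    ultimately show ?thesis
      by (intro splitting_imp_shadowing[of "blocks {..0}" "space M - blocks {..0}"]) auto
  qed
qed

section \<open>From shadowing to growth\<close>

lemma E_in_image_iff: "x \<in> space M \<Longrightarrow> G \<subseteq> space M \<Longrightarrow> E j x \<in> E k ` G \<longleftrightarrow> x \<in> E (k - j) ` G"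
  by (subst (1 2) image_E) (auto simp: E_space E_add algebra_simps)

lemma block_orlicz: "(\<lambda>x. s * indicator (E k ` W) x) \<in> orlicz_fun M \<Phi>"
proof -
  have "gauge_norm M \<Phi> (\<lambda>x. 1 * indicator (E k ` W) x) < \<infinity>"
    using emeasure_image_pos[OF W_sets W_pos] emeasure_image_finite[OF W_sets W_finite]
    by (subst gauge_scaled_indicator) (auto simp: sets_image_E)
  then have "indicator (E k ` W) \<in> orlicz_fun M \<Phi>"
    by (auto simp: orlicz_fun_iff_gauge sets_image_E intro!: borel_measurable_indicator)
  then show ?thesis by (rule orlicz_fun_scale)
qed

lemma gauge_block:
  "0 < s \<Longrightarrow> gauge_norm M \<Phi> (\<lambda>x. s * indicator (E k ` W) x) = ennreal (s / a k)"
  unfolding a_def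
  by (intro gauge_scaled_indicator sets_image_E emeasure_image_pos emeasure_image_finite W_sets W_pos W_finite)

text \<open>
By Chebyshev's inequality for the gauge, the points of W_k where the deviation exceeds 3Ka_k form
a set whose indicator has at most 1/(3K) of the gauge of \<chi>_(W_k). Distortion transports this to
W at the cost of the factor K, and what remains is the fraction 1/3. Two such exceptional sets
do not cover W.
\<close>

lemma deviation_set_small:
  assumes z [measurable]: "z \<in> borel_measurable M"
    and le: "gauge_norm M \<Phi> (\<lambda>x. z (E (- k) x) - s * indicator (E k ` W) x) < 1"
  shows "measure M {w \<in> W. 3 * K * a k < \<bar>z w - s\<bar>} \<le> measure M W / 3"
proof -
  define G where "G = {w \<in> W. 3 * K * a k < \<bar>z w - s\<bar>}"
  have "G = {w \<in> space M. w \<in> W \<and> 3 * K * a k < \<bar>z w - s\<bar>}" using W_space by (auto simp: G_def)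
  then have G: "G \<in> sets M" by simp
  have GW: "G \<subseteq> W" by (auto simp: G_def)
  show ?thesis
  proof (cases "emeasure M G = 0")
    case True
    then show ?thesis by (simp add: measure_def flip: G_def)
  next
    case False
    then have Gpos: "0 < emeasure M G" by (simp add: zero_less_iff_neq_zero)
    have Gfin: "emeasure M G < \<infinity>" using emeasure_mono[OF GW W_sets] W_finite by (rule le_less_trans)
    have R: "0 < 3 * K * a k" using K_ge_1 a_pos[of k] by simp
    define L where "L = level M (E k ` G)"
    have L: "0 < L" unfolding L_def by (intro level_pos emeasure_image_pos emeasure_image_finite G Gpos Gfin)
    have "ennreal (3 * K * a k / L) = gauge_norm M \<Phi> (\<lambda>x. 3 * K * a k * indicator (E k ` G) x)"
      unfolding L_def using R
      by (intro gauge_scaled_indicator[symmetric] sets_image_E emeasure_image_pos emeasure_image_finite G Gpos Gfin)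
    also have "\<dots> \<le> gauge_norm M \<Phi> (\<lambda>x. z (E (- k) x) - s * indicator (E k ` W) x)"
    proof (rule gauge_mono)
      fix x
      show "\<bar>3 * K * a k * indicator (E k ` G) x\<bar> \<le> \<bar>z (E (- k) x) - s * indicator (E k ` W) x\<bar>"
      proof (cases "x \<in> E k ` G")
        case True
        then obtain w where w: "w \<in> G" "x = E k w" by blast
        then have "w \<in> space M" using GW W_space by blast
        then have "E (- k) x = w" using w by (simp add: E_add E_zero)
        then show ?thesis using w R True GW by (auto simp: G_def)
      qed simp
    qed
    also have "\<dots> < 1" by (rule le)
    finally have "3 * K * a k < L" using L R ennreal_less_iff[of "3 * K * a k / L" 1] by simp
    then have "3 * K * a k * level M W \<le> L * level M W"
      using level_pos[OF W_pos W_finite] by (intro mult_right_mono) auto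
    also have "\<dots> \<le> K * (a k * level M G)"
      using distortion_upper[OF G GW Gpos, of k] by (simp add: L_def a_def)
    finally have "(K * a k) * (3 * level M W) \<le> (K * a k) * level M G" by (simp add: mult_ac)
    then have "3 * level M W \<le> level M G" using K_ge_1 a_pos[of k] by simp
    then have lvl: "inv_\<Phi> (1 / measure M W) \<le> 1/3 * inv_\<Phi> (1 / measure M G)" by (simp add: level_def)
    have mpos: "0 < measure M W" "0 < measure M G"
      using W_pos W_finite Gpos Gfin by (simp_all add: measure_def enn2real_positive_iff)
    have "1 / measure M W \<le> 1/3 * (1 / measure M G)"
      by (rule inverse_less_imp_ratio[OF _ _ _ lvl]) (use mpos in simp_all)
    then show ?thesis unfolding G_def[symmetric] using mpos by (simp add: field_simps)
  qed
qed

text \<open>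
The pseudo-orbit is y_n=S(-n)\<chi>_(W_(-n)) with S(k)=\<delta>\<Sum>_(max(p,k) \<le> j<r) a_j. At time
-r it is zero, and between the times -r and -p it collects one error of norm \<delta> in each step.
\<close>

lemma shadowing_imp_endpoint_bound:
  assumes "has_shadowing_property Y T"
  shows "\<exists>C. \<forall>p r. p \<le> r \<longrightarrow> (\<Sum>k\<in>{p..<r}. a k) \<le> C * (a p + a r)"
proof -
  obtain \<delta> where \<delta>: "0 < \<delta>" and shadow: "\<And>y :: int \<Rightarrow> 'a \<Rightarrow> real. (\<And>n. y n \<in> orlicz_fun M \<Phi>) \<Longrightarrow>
      (\<And>n. gauge_norm M \<Phi> (\<lambda>x. y n (E 1 x) - y (n + 1) x) \<le> ennreal \<delta>) \<Longrightarrow>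
      \<exists>z\<in>orlicz_fun M \<Phi>. \<forall>n. gauge_norm M \<Phi> (\<lambda>x. z (E n x) - y n x) < 1"
    using assms unfolding shadowing_iff_functions by (auto dest!: spec[of _ 1])
  have "(\<Sum>k\<in>{p..<r}. a k) \<le> 3 * K / \<delta> * (a p + a r)" if "p \<le> r" for p r
  proof -
    define S where "S k = \<delta> * (\<Sum>j\<in>{max p k..<r}. a j)" for k
    define y where "y n x = S (- n) * indicator (E (- n) ` W) x" for n x
    have S_step: "\<bar>S (k + 1) - S k\<bar> \<le> \<delta> * a k" for k
    proof (cases "p \<le> k \<and> k < r")
      case True
      then have "{max p k..<r} = insert k {max p (k + 1)..<r}" by auto
      then have "S k = \<delta> * a k + S (k + 1)" by (simp add: S_def algebra_simps)
      then show ?thesis using \<delta> a_pos[of k] by simp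
    next
      case False
      then have "{max p k..<r} = {max p (k + 1)..<r}" by auto
      then show ?thesis using \<delta> a_pos[of k] by (simp add: S_def)
    qed
    have err: "gauge_norm M \<Phi> (\<lambda>x. y n (E 1 x) - y (n + 1) x) \<le> ennreal \<delta>" for n
    proof -
      define k where "k = - n - 1"
      have "gauge_norm M \<Phi> (\<lambda>x. y n (E 1 x) - y (n + 1) x) \<le>
          gauge_norm M \<Phi> (\<lambda>x. (\<delta> * a k) * indicator (E k ` W) x)"
      proof (rule gauge_mono)
        fix x assume x: "x \<in> space M"
        have "y n (E 1 x) - y (n + 1) x = (S (k + 1) - S k) * indicator (E k ` W) x"
          using E_in_image_iff[OF x W_space, of 1 "- n"]
          by (simp add: y_def k_def indicator_def)
        then show "\<bar>y n (E 1 x) - y (n + 1) x\<bar> \<le> \<bar>(\<delta> * a k) * indicator (E k ` W) x\<bar>"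
          using S_step[of k] by (auto simp: indicator_def)
      qed
      also have "\<dots> = ennreal \<delta>" using \<delta> a_pos[of k] by (subst gauge_block) auto
      finally show ?thesis .
    qed
    have "y n \<in> orlicz_fun M \<Phi>" for n unfolding y_def[abs_def] by (rule block_orlicz)
    from shadow[of y, OF this err] obtain z where z: "z \<in> orlicz_fun M \<Phi>"
      and close: "\<And>n. gauge_norm M \<Phi> (\<lambda>x. z (E n x) - y n x) < 1" by blast
    have zm: "z \<in> borel_measurable M" using z by (simp add: orlicz_fun_def)
    define Bad where "Bad k = {w \<in> W. 3 * K * a k < \<bar>z w - S k\<bar>}" for k
    have bad: "measure M (Bad k) \<le> measure M W / 3" for k
      unfolding Bad_def using close[of "- k"] by (intro deviation_set_small zm) (simp add: y_def)
    have "Bad p \<union> Bad r \<noteq> W"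
    proof
      assume eq: "Bad p \<union> Bad r = W"
      have Bs: "Bad k \<in> sets M" for k
      proof -
        have "Bad k = {w \<in> space M. w \<in> W \<and> 3 * K * a k < \<bar>z w - S k\<bar>}" using W_space by (auto simp: Bad_def)
        then show ?thesis using zm by simp
      qed
      have "measure M W \<le> measure M (Bad p) + measure M (Bad r)"
        unfolding eq[symmetric] by (rule measure_Un_le[OF Bs Bs])
      also have "\<dots> \<le> measure M W / 3 + measure M W / 3" by (intro add_mono bad)
      finally have "measure M W \<le> 0" by simp
      moreover have "0 < measure M W"
        using W_pos W_finite by (simp add: measure_def enn2real_positive_iff)
      ultimately show False by simp
    qed
    then obtain w where "w \<in> W" "w \<notin> Bad p" "w \<notin> Bad r" by (auto simp: Bad_def)
    then have "\<bar>z w - S p\<bar> \<le> 3 * K * a p" "\<bar>z w - S r\<bar> \<le> 3 * K * a r" by (auto simp: Bad_def)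
    moreover have "S r = 0" "S p = \<delta> * (\<Sum>k\<in>{p..<r}. a k)" using that by (auto simp: S_def)
    ultimately have "\<delta> * (\<Sum>k\<in>{p..<r}. a k) \<le> 3 * K * (a p + a r)" by (simp add: algebra_simps)
    then show ?thesis using \<delta> by (simp add: field_simps)
  qed
  then show ?thesis by blast
qed

theorem shadowing_iff_growth:
  "has_shadowing_property Y T \<longleftrightarrow>
    grows_leftwards a UNIV \<or> grows_leftwards (a \<circ> uminus) UNIV \<or>
    grows_leftwards a {..0} \<and> grows_leftwards (a \<circ> uminus) {..0}"
proof
  assume "has_shadowing_property Y T"
  then obtain C where "\<And>p r. p \<le> r \<Longrightarrow> (\<Sum>k\<in>{p..<r}. a k) \<le> C * (a p + a r)"
    using shadowing_imp_endpoint_bound by blast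
  then show "grows_leftwards a UNIV \<or> grows_leftwards (a \<circ> uminus) UNIV \<or>
    grows_leftwards a {..0} \<and> grows_leftwards (a \<circ> uminus) {..0}"
    using a_ratio[of _ 1] a_ratio[of _ "-1"] c_ge_1 a_ratio[of "k - 1" 1 for k]
    by (intro endpoint_bound_imp_exponential_growth[of a c C] a_pos) auto
qed (rule growth_imp_shadowing)

end

section \<open>The degenerate case\<close>

text \<open>
If \<Phi> is infinite off 0, a function of finite modular vanishes almost everywhere, so the space
is trivial.
\<close>

lemma (in orlicz_action) improper_imp_shadowing:
  assumes "\<And>b. 0 < b \<Longrightarrow> \<Phi> b = \<infinity>"
  shows "has_shadowing_property Y T"
proof -
  have null: "AE x in M. f x = 0" if f: "f \<in> orlicz_fun M \<Phi>" for f
  proof -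
    from f obtain k where k: "0 < k" "modular M (\<lambda>x. k * f x) < \<infinity>"
      and [measurable]: "f \<in> borel_measurable M" by (auto simp: orlicz_fun_def)
    have "AE x in M. \<Phi> (k * f x) \<noteq> \<infinity>" using k by (intro nn_integral_PInf_AE) auto
    then show ?thesis
    proof eventually_elim
      case (elim x)
      show "f x = 0"
      proof (rule ccontr)
        assume "f x \<noteq> 0"
        then have "\<Phi> \<bar>k * f x\<bar> = \<infinity>" using k by (intro assms) simp
        with elim show False by (simp only: apply_abs)
      qed
    qed
  qed
  show ?thesis
    unfolding shadowing_iff_functions
  proof (intro allI impI exI[of _ 1] conjI; (elim conjE)?)
    fix \<epsilon> :: real and y :: "int \<Rightarrow> 'a \<Rightarrow> real"
    assume \<epsilon>: "0 < \<epsilon>" and y: "\<forall>n. y n \<in> orlicz_fun M \<Phi>"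
    have "gauge_norm M \<Phi> (\<lambda>x. 0 - y n x) < ennreal \<epsilon>" for n
    proof -
      have "AE x in M. 0 - y n x = 0" using null[of "y n"] y by simp
      then show ?thesis using \<epsilon> by (simp only: gauge_AE_0) simp
    qed
    then show "\<exists>z\<in>orlicz_fun M \<Phi>. \<forall>n. gauge_norm M \<Phi> (\<lambda>x. z (E n x) - y n x) < ennreal \<epsilon>"
      by (intro bexI[of _ "\<lambda>x. 0"] orlicz_fun_zero) blast
  qed simp
qed

section \<open>Integer iterates of a bijection\<close>

lemma int_iterate_in:
  assumes "bij_betw f S S" "x \<in> S" shows "int_iterate S f k x \<in> S"
proof -
  have f: "f ` S \<subseteq> S" "inv_into S f ` S \<subseteq> S"
    using assms(1) bij_betw_inv_into[OF assms(1)] by (auto simp: bij_betw_def)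
  have "(g ^^ n) x \<in> S" if "g ` S \<subseteq> S" for g n using assms(2) that by (induction n) auto
  then show ?thesis using f by (simp add: int_iterate_def)
qed

lemma int_iterate_succ:
  assumes "bij_betw f S S" "x \<in> S" shows "int_iterate S f (k + 1) x = f (int_iterate S f k x)"
proof (cases "0 \<le> k")
  case True
  then show ?thesis by (simp add: int_iterate_def nat_add_distrib)
next
  case False
  define m where "m = nat (- k - 1)"
  have m: "nat (- k) = Suc m" using False by (simp add: m_def)
  have "int_iterate S f (- int m) x = (inv_into S f ^^ m) x"
    by (cases "m = 0") (auto simp: int_iterate_def)
  moreover have "- int m = k + 1" using False by (simp add: m_def)
  ultimately have eq: "int_iterate S f (k + 1) x = (inv_into S f ^^ m) x" by simp
  have "(inv_into S f ^^ m) x \<in> f ` S"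
    using int_iterate_in[OF assms, of "k + 1"] assms(1) by (simp add: eq bij_betw_def)
  then have "f (inv_into S f ((inv_into S f ^^ m) x)) = (inv_into S f ^^ m) x" by (rule f_inv_into_f)
  with False m eq show ?thesis by (simp add: int_iterate_def)
qed

lemma int_iterate_add:
  assumes "bij_betw f S S" "x \<in> S"
  shows "int_iterate S f j (int_iterate S f k x) = int_iterate S f (j + k) x"
proof (induction j rule: int_induct[where k = 0])
  case base
  show ?case by (simp add: int_iterate_def)
next
  case (step1 i)
  then show ?case
    using int_iterate_succ[OF assms, of "i + k"] int_iterate_succ[OF assms(1) int_iterate_in[OF assms, of k], of i]
    by (simp add: algebra_simps)
next
  case (step2 i)
  have "f (int_iterate S f (i - 1) (int_iterate S f k x)) = f (int_iterate S f (i - 1 + k) x)"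
    using step2 int_iterate_succ[OF assms, of "i - 1 + k"]
      int_iterate_succ[OF assms(1) int_iterate_in[OF assms, of k], of "i - 1"]
    by (simp add: algebra_simps)
  then show ?case
    using assms by (auto simp: bij_betw_def inj_on_def int_iterate_in)
qed

lemma measurable_int_iterate:
  assumes "f \<in> measurable M M" "inv_into (space M) f \<in> measurable M M"
  shows "int_iterate (space M) f k \<in> measurable M M"
proof -
  have "g ^^ n \<in> measurable M M" if "g \<in> measurable M M" for g n
    using that by (induction n) (auto intro: measurable_comp)
  then show ?thesis using assms by (simp add: int_iterate_def)
qed

section \<open>The equivalence\<close>

theorem corollary2p20:
  fixes M :: "'a measure" and \<Phi> :: "real \<Rightarrow> ennreal" and \<phi> :: "'a \<Rightarrow> 'a" and W :: "'a set"
    and a :: "int \<Rightarrow> real"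
  assumes "sigma_finite_measure M" and "complete_measure M"
    and "young_function \<Phi>"
    and "dissipative_system M \<phi> W" and "bounded_distortion M \<Phi> \<phi> W"
    and "domination_condition M \<phi>"
    and "domination_condition M (inv_into (space M) \<phi>)"
    and "invertible_operator (orlicz_space M \<Phi>) (composition_operator M \<Phi> \<phi>)"
    and "\<And>k. a k = young_inverse \<Phi> (1 / measure M (int_iterate (space M) \<phi> k ` W))"
  shows "has_shadowing_property (orlicz_space M \<Phi>) (composition_operator M \<Phi> \<phi>) \<longleftrightarrow>
      limsup (\<lambda>n. SUP k. ereal ((a (k + int n) / a k) powr (1 / real n))) < 1 \<or>
      liminf (\<lambda>n. INF k. ereal ((a (k + int n) / a k) powr (1 / real n))) > 1 \<or>
      (limsup (\<lambda>n. SUP k\<in>{..0}. ereal ((a k / a (k - int n)) powr (1 / real n))) < 1 \<and>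
       liminf (\<lambda>n. INF k\<in>{0..}. ereal ((a (k + int n) / a k) powr (1 / real n))) > 1)"
    (is "?shadowing \<longleftrightarrow> ?conditions")
proof -
  define E where "E = int_iterate (space M) \<phi>"
  have bij: "bij_betw \<phi> (space M) (space M)"
    and meas: "\<phi> \<in> measurable M M" "inv_into (space M) \<phi> \<in> measurable M M"
    and W: "W \<in> sets M" "0 < emeasure M W" "emeasure M W < \<infinity>"
    and disj: "disjoint_family (\<lambda>k. E k ` W)" and cover: "(\<Union>k. E k ` W) = space M"
    using assms(4) by (auto simp: dissipative_system_def invertible_transformation_def E_def)
  have E1: "E 1 = \<phi>" "E (- 1) = inv_into (space M) \<phi>" by (auto simp: E_def int_iterate_def)
  obtain c1 c2 where c1: "\<And>F. F \<in> sets M \<Longrightarrow> emeasure M (\<phi> -` F \<inter> space M) \<le> ennreal c1 * emeasure M F"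
    and c2: "\<And>F. F \<in> sets M \<Longrightarrow> emeasure M (inv_into (space M) \<phi> -` F \<inter> space M) \<le> ennreal c2 * emeasure M F"
    using assms(6,7) unfolding domination_condition_def by blast
  define c where "c = max 1 (max c1 c2)"
  interpret orlicz_action \<Phi> M E c
  proof unfold_locales
    show "young_function \<Phi>" by fact
    show "E k \<in> measurable M M" for k unfolding E_def by (intro measurable_int_iterate meas)
    show "E j (E k x) = E (j + k) x" if "x \<in> space M" for j k x
      unfolding E_def by (rule int_iterate_add[OF bij that])
    show "E 0 x = x" for x by (simp add: E_def int_iterate_def)
    show "1 \<le> c" by (simp add: c_def)
    fix \<sigma> :: int and F assume \<sigma>: "\<sigma> \<in> {1, - 1}" and F: "F \<in> sets M"
    have "ennreal c1 * emeasure M F \<le> ennreal c * emeasure M F" "ennreal c2 * emeasure M F \<le> ennreal c * emeasure M F"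
      by (auto simp: c_def intro!: mult_right_mono ennreal_leI)
    with \<sigma> c1[OF F] c2[OF F] show "emeasure M (E \<sigma> -` F \<inter> space M) \<le> ennreal c * emeasure M F"
      by (auto simp: E1 intro: order_trans)
  qed
  show ?thesis
  proof (cases "\<exists>b>0. \<Phi> b < \<infinity>")
    case False
    then have improper: "\<Phi> b = \<infinity>" if "0 < b" for b using that by (auto simp: less_top[symmetric])
    have "?shadowing" using improper_imp_shadowing[OF improper] by (simp add: E1)
    \<comment> \<open>The inverse is the infimum of the positive reals, so that all quotients are 0/0=0.\<close>
    moreover have "a k = 0" for k
    proof -
      define y where "y = 1 / measure M (int_iterate (space M) \<phi> k ` W)"
      have "{x. 0 \<le> x \<and> ennreal y < \<Phi> x} = {0<..}"
      proof (intro set_eqI iffI)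
        fix x assume "x \<in> {x. 0 \<le> x \<and> ennreal y < \<Phi> x}"
        then show "x \<in> {0<..}" by (cases "x = 0") auto
      qed (auto simp: improper)
      then show ?thesis unfolding assms(9) young_inverse_def y_def by simp
    qed
    then have "limsup (\<lambda>n. SUP k. ereal ((a (k + int n) / a k) powr (1 / real n))) < 1"
      by (simp add: Limsup_const)
    ultimately show ?thesis by blast
  next
    case True
    interpret proper_young_fn \<Phi> by unfold_locales (rule True)
    obtain K where K: "0 < K" and dist: "\<And>k G. G \<in> sets M \<Longrightarrow> G \<subseteq> W \<Longrightarrow>
        ennreal (1 / K) * gauge_norm M \<Phi> (indicator W \<circ> E k) * gauge_norm M \<Phi> (indicator G)
          \<le> gauge_norm M \<Phi> (indicator G \<circ> E k) * gauge_norm M \<Phi> (indicator W) \<and>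
        gauge_norm M \<Phi> (indicator G \<circ> E k) * gauge_norm M \<Phi> (indicator W)
          \<le> ennreal K * gauge_norm M \<Phi> (indicator W \<circ> E k) * gauge_norm M \<Phi> (indicator G)"
      using assms(5) unfolding bounded_distortion_def Let_def E_def[symmetric] by blast
    have gauge: "gauge_norm M \<Phi> (indicator G) = ennreal (1 / level M G)"
      "gauge_norm M \<Phi> (indicator G \<circ> E k) = ennreal (1 / level M (E (- k) ` G))"
      "0 < level M G" "0 < level M (E k ` G)"
      if G: "G \<in> sets M" "0 < emeasure M G" "emeasure M G < \<infinity>" for G k
    proof -
      show "0 < level M G" "0 < level M (E k ` G)"
        unfolding level_def using G emeasure_image_pos[OF G(1,2), of k] emeasure_image_finite[OF G(1,3), of k]
        by (auto intro!: inverse_pos simp: measure_def enn2real_positive_iff)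
      show "gauge_norm M \<Phi> (indicator G) = ennreal (1 / level M G)"
        using gauge_scaled_indicator[OF G, of 1] by simp
      have "gauge_norm M \<Phi> (indicator G \<circ> E k) = gauge_norm M \<Phi> (indicator (E (- k) ` G))"
        using sets.sets_into_space[OF G(1)]
        by (intro gauge_cong_AE AE_I2) (auto simp: image_E indicator_def)
      also have "\<dots> = ennreal (1 / level M (E (- k) ` G))"
        using gauge_scaled_indicator[of "E (- k) ` G" M 1] G
        by (simp add: sets_image_E emeasure_image_pos emeasure_image_finite[simplified])
      finally show "gauge_norm M \<Phi> (indicator G \<circ> E k) = ennreal (1 / level M (E (- k) ` G))" .
    qed
    have distortion: "level M (E k ` G) * level M W \<le> max K 1 * (level M (E k ` W) * level M G)"
      "level M (E k ` W) * level M G \<le> max K 1 * (level M (E k ` G) * level M W)"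
      if G: "G \<in> sets M" "G \<subseteq> W" "0 < emeasure M G" for k G
    proof -
      have Gfin: "emeasure M G < \<infinity>" using emeasure_mono[OF G(2) W(1)] W(3) by (rule le_less_trans)
      note g = gauge[OF G(1,3) Gfin] gauge[OF W]
      define lk wk lG lW where "lk = level M (E k ` G)" and "wk = level M (E k ` W)"
        and "lG = level M G" and "lW = level M W"
      have pos: "0 < lk" "0 < wk" "0 < lG" "0 < lW"
        using g by (auto simp: lk_def wk_def lG_def lW_def)
      have "ennreal (1 / K) * ennreal (1 / wk) * ennreal (1 / lG) \<le> ennreal (1 / lk) * ennreal (1 / lW)"
        "ennreal (1 / lk) * ennreal (1 / lW) \<le> ennreal K * ennreal (1 / wk) * ennreal (1 / lG)"
        using dist[OF G(1,2), of "- k"] g by (auto simp: lk_def wk_def lG_def lW_def)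
      then have "1 / K * (1 / wk) * (1 / lG) \<le> 1 / lk * (1 / lW)"
        "1 / lk * (1 / lW) \<le> K * (1 / wk) * (1 / lG)"
        using pos K by (simp_all flip: ennreal_mult)
      then have "lk * lW \<le> K * (wk * lG)" "wk * lG \<le> K * (lk * lW)"
        using pos K by (simp_all add: field_simps)
      moreover have "K * (wk * lG) \<le> max K 1 * (wk * lG)" "K * (lk * lW) \<le> max K 1 * (lk * lW)"
        using pos by (auto intro!: mult_right_mono)
      ultimately show "level M (E k ` G) * level M W \<le> max K 1 * (level M (E k ` W) * level M G)"
        "level M (E k ` W) * level M G \<le> max K 1 * (level M (E k ` G) * level M W)"
        by (auto simp flip: lk_def wk_def lG_def lW_def)
    qed
    interpret sys: wandering_system \<Phi> M E c W "max K 1"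
      by unfold_locales (use W disj cover distortion in auto)
    have "a = sys.a" by (rule ext) (simp add: assms(9) sys.a_def level_def flip: E_def)
    moreover have "0 < sys.a k" for k by (rule sys.a_pos)
    ultimately show ?thesis
      using sys.shadowing_iff_growth by (simp only: growth_conditions_iff E1)
  qed
qed

end
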